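(* Let $\Gamma$ be a Coxeter graph with finite vertex set $S$, let $(W,S)$ be its Coxeter system, let $G$ be a group of symmetries of $\Gamma$, and let $(V,\langle .,.\rangle,\Pi)$, $\Pi=\{\epsilon_s\mid s\in S\}$, be a root basis of $\Gamma$. Assume that $G$ embeds in $\mathrm{GL}(V)$ in such a way that $g(\epsilon_s)=\epsilon_{g(s)}$ for all $g\in G$ and all $s\in S$, and the form $\langle .,.\rangle$ is invariant under $G$. Let $f:W\to \mathrm{GL}(V)$ be the rooted representation of $W$ associated with $(V,\langle .,.\rangle,\Pi)$, and let $f^G:W^G\to \mathrm{GL}(V^G)$ be the induced representation. Then: (1) The group $W^G$ is a Coxeter group, i.e. there is a subset $\tilde S\subset W^G$ such that $(W^G,\tilde S)$ is a Coxeter system. (2) Moreover, $\tilde S$ can be chosen so that, denoting by $\tilde\Gamma$ the Coxeter graph of $(W^G,\tilde S)$, there exists a subset $\tilde\Pi$ of $V^G$ such that $(V^G,\langle .,.\rangle,\tilde\Pi)$ (with the restricted form) is a root basis of $\tilde\Gamma$, and $f^G:W^G\to \mathrm{GL}(V^G)$ is the rooted representation associated with $(V^G,\langle .,.\rangle,\tilde\Pi)$. In particular, $f^G$ is faithful.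
   Context: A Coxeter graph $\Gamma$ with vertex set $S$ encodes a Coxeter matrix $(m_{s,t})_{s,t\in S}$ ($m_{s,s}=1$, $m_{s,t}=m_{t,s}\in\{2,3,\dots\}\cup\{\infty\}$ for $s\ne t$): two distinct vertices $s,t$ are joined by an edge iff $m_{s,t}\ge 3$, and the edge is labelled $m_{s,t}$ (label 3 usually omitted). Its Coxeter system is $(W,S)$ with $W=\langle S\mid (st)^{m_{s,t}}=1 \text{ for all } s,t\in S \text{ with } m_{s,t}\neq\infty\rangle$. A symmetry of $\Gamma$ is a permutation $g$ of $S$ with $m_{g(s),g(t)}=m_{s,t}$ for all $s,t\in S$. A group $G$ of symmetries acts on $W$ by automorphisms extending its action on $S$; $W^G$ is the subgroup of elements of $W$ fixed by all of $G$. A root basis of $\Gamma$ is a triple $(V,\langle .,.\rangle,\Pi)$, where $V$ is a finite dimensional real vector space, $\langle .,.\rangle$ is a symmetric bilinear form on $V$, and $\Pi=\{\epsilon_s\mid s\in S\}$ is a collection of vectors of $V$ in one-to-one correspondence with $S$ such that: (a) $\langle\epsilon_s,\epsilon_s\rangle=1$ for all $s\in S$; (b) for all $s\ne t$ in $S$, $\langle\epsilon_s,\epsilon_t\rangle=-\cos(\pi/m_{s,t})$ if $m_{s,t}\ne\infty$, and $\langle\epsilon_s,\epsilon_t\rangle\in(-\infty,-1]$ if $m_{s,t}=\infty$; (c) there exists $\chi\in V^*$ with $\chi(\epsilon_s)>0$ for all $s\in S$. ($\Pi$ is not required to be a basis of $V$.) For $s\in S$ let $f_s:V\to V$, $f_s(x)=x-2\langle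 x,\epsilon_s\rangle\epsilon_s$. The map $s\mapsto f_s$ extends to a faithful linear representation $f:W\to\mathrm{GL}(V)$ (a theorem of Krammer), called the rooted representation of $W$ associated with $(V,\langle .,.\rangle,\Pi)$. Let $V^G=\{x\in V\mid g(x)=x\text{ for all }g\in G\}$. Under the assumptions on $G$, $f(g(w))=g\circ f(w)\circ g^{-1}$ for all $g\in G$, $w\in W$, so $f(w)$ preserves $V^G$ for $w\in W^G$, and $f^G:W^G\to\mathrm{GL}(V^G)$ is defined by $f^G(w)=f(w)|_{V^G}$. *)

theory Defs
  imports Complex_Main "HOL-Algebra.Bij" "HOL-Library.Extended_Nat"
begin

section \<open>Group presentations\<close>

text \<open>A word over \<open>S \<union> S\<inverse>\<close>: the letter \<open>(s, True)\<close> stands for \<open>s\<close>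
  and \<open>(s, False)\<close> for the inverse of \<open>s\<close>.\<close>

type_synonym 'a word = "('a \<times> bool) list"

definition words :: "'a set \<Rightarrow> 'a word set" where
  "words S = lists (S \<times> UNIV)"

definition word_eval :: "('a, 'b) monoid_scheme \<Rightarrow> 'a word \<Rightarrow> 'a" where
  "word_eval W u =
     foldr (\<lambda>(s, pos) x. (if pos then s else inv\<^bsub>W\<^esub> s) \<otimes>\<^bsub>W\<^esub> x) u \<one>\<^bsub>W\<^esub>"

inductive word_reduce :: "'a set \<Rightarrow> 'a word set \<Rightarrow> 'a word \<Rightarrow> 'a word \<Rightarrow> bool"
  for S R where
  cancel: "s \<in> S \<Longrightarrow> word_reduce S R (u @ [(s, pos), (s, \<not> pos)] @ v) (u @ v)"
| relator: "r \<in> R \<Longrightarrow> word_reduce S R (u @ r @ v) (u @ v)"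

text \<open>\<open>equivclp (word_reduce S R)\<close> is the congruence on words whose quotient is the group
  \<open>\<langle>S | r = 1 for r \<in> R\<rangle>\<close>, so the definition below says that evaluation of words
  induces an isomorphism from that group onto \<open>W\<close>.\<close>

definition presented_by :: "('a, 'b) monoid_scheme \<Rightarrow> 'a set \<Rightarrow> 'a word set \<Rightarrow> bool" where
  "presented_by W S R \<longleftrightarrow>
     group W \<and> S \<subseteq> carrier W \<and>
     word_eval W ` words S = carrier W \<and>
     (\<forall>u\<in>words S. \<forall>v\<in>words S.
        word_eval W u = word_eval W v \<longleftrightarrow> equivclp (word_reduce S R) u v)"

section \<open>Coxeter systems\<close>

text \<open>A Coxeter graph is represented by the Coxeter matrix \<open>m\<close> on \<open>S\<close> that it encodes.\<close>

definition coxeter_matrix :: "'s set \<Rightarrow> ('s \<Rightarrow> 's \<Rightarrow> enat) \<Rightarrow> bool" where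
  "coxeter_matrix S m \<longleftrightarrow>
     (\<forall>s\<in>S. m s s = 1) \<and>
     (\<forall>s\<in>S. \<forall>t\<in>S. s \<noteq> t \<longrightarrow> m s t = m t s \<and> 2 \<le> m s t)"

definition coxeter_relators :: "'s set \<Rightarrow> ('s \<Rightarrow> 's \<Rightarrow> enat) \<Rightarrow> 's word set" where
  "coxeter_relators S m =
     {concat (replicate n [(s, True), (t, True)]) | s t n. s \<in> S \<and> t \<in> S \<and> m s t = enat n}"

definition coxeter_system ::
  "('w, 'b) monoid_scheme \<Rightarrow> 'w set \<Rightarrow> ('w \<Rightarrow> 'w \<Rightarrow> enat) \<Rightarrow> bool" where
  "coxeter_system W S m \<longleftrightarrow> coxeter_matrix S m \<and> presented_by W S (coxeter_relators S m)"

section \<open>Symmetries and their action\<close>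

definition coxeter_symmetries :: "'s set \<Rightarrow> ('s \<Rightarrow> 's \<Rightarrow> enat) \<Rightarrow> ('s \<Rightarrow> 's) set" where
  "coxeter_symmetries S m = {g \<in> Bij S. \<forall>s\<in>S. \<forall>t\<in>S. m (g s) (g t) = m s t}"

definition symmetry_group :: "'s set \<Rightarrow> ('s \<Rightarrow> 's \<Rightarrow> enat) \<Rightarrow> ('s \<Rightarrow> 's) set \<Rightarrow> bool" where
  "symmetry_group S m G \<longleftrightarrow> subgroup G (BijGroup S) \<and> G \<subseteq> coxeter_symmetries S m"

text \<open>The automorphism of \<open>W\<close> extending a permutation of the generators; it is well-defined
  for symmetries by \<open>ex1_symmetry_extension\<close> below. Elements of \<open>auto W\<close> are extensional
  on \<open>carrier W\<close>.\<close>

definition symmetry_extension ::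
  "('w, 'b) monoid_scheme \<Rightarrow> 'w set \<Rightarrow> ('w \<Rightarrow> 'w) \<Rightarrow> 'w \<Rightarrow> 'w" where
  "symmetry_extension W S g = (THE \<phi>. \<phi> \<in> auto W \<and> (\<forall>s\<in>S. \<phi> s = g s))"

definition fixed_subgroup ::
  "('w, 'b) monoid_scheme \<Rightarrow> 'w set \<Rightarrow> ('w \<Rightarrow> 'w) set \<Rightarrow> ('w, 'b) monoid_scheme" where
  "fixed_subgroup W S G =
     W\<lparr>carrier := {w \<in> carrier W. \<forall>g\<in>G. symmetry_extension W S g w = w}\<rparr>"

section \<open>Root bases and rooted representations\<close>

text \<open>Vector spaces are finite-dimensional subspaces \<open>V\<close> of an ambient real vector space, so that
  a space and its subspace of fixed vectors are treated alike. Maps on \<open>V\<close> and forms on \<open>V\<close> are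
  only constrained on \<open>V\<close>.\<close>

definition fin_dim_subspace :: "'v::real_vector set \<Rightarrow> bool" where
  "fin_dim_subspace V \<longleftrightarrow> (\<exists>E. finite E \<and> span E = V)"

definition linear_on :: "'v::real_vector set \<Rightarrow> ('v \<Rightarrow> 'u::real_vector) \<Rightarrow> bool" where
  "linear_on V f \<longleftrightarrow>
     (\<forall>x\<in>V. \<forall>y\<in>V. f (x + y) = f x + f y) \<and> (\<forall>c. \<forall>x\<in>V. f (c *\<^sub>R x) = c *\<^sub>R f x)"

definition symmetric_bilinear_on :: "'v::real_vector set \<Rightarrow> ('v \<Rightarrow> 'v \<Rightarrow> real) \<Rightarrow> bool" where
  "symmetric_bilinear_on V B \<longleftrightarrow>
     (\<forall>x\<in>V. linear_on V (B x)) \<and> (\<forall>y\<in>V. linear_on V (\<lambda>x. B x y)) \<and>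
     (\<forall>x\<in>V. \<forall>y\<in>V. B x y = B y x)"

definition GL :: "'v::real_vector set \<Rightarrow> ('v \<Rightarrow> 'v) monoid" where
  "GL V = BijGroup V\<lparr>carrier := {f \<in> Bij V. linear_on V f}\<rparr>"

text \<open>The set \<open>\<Pi>\<close> is given by its indexing \<open>\<epsilon>\<close>, i.e. \<open>\<Pi> = \<epsilon> ` S\<close>.\<close>

definition root_basis ::
  "'s set \<Rightarrow> ('s \<Rightarrow> 's \<Rightarrow> enat) \<Rightarrow> 'v::real_vector set \<Rightarrow> ('v \<Rightarrow> 'v \<Rightarrow> real) \<Rightarrow> ('s \<Rightarrow> 'v) \<Rightarrow> bool"
where
  "root_basis S m V B \<epsilon> \<longleftrightarrow>
     fin_dim_subspace V \<and> symmetric_bilinear_on V B \<and>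
     \<epsilon> ` S \<subseteq> V \<and> inj_on \<epsilon> S \<and>
     (\<forall>s\<in>S. B (\<epsilon> s) (\<epsilon> s) = 1) \<and>
     (\<forall>s\<in>S. \<forall>t\<in>S. s \<noteq> t \<longrightarrow>
        (case m s t of
           enat n \<Rightarrow> B (\<epsilon> s) (\<epsilon> t) = - cos (pi / real n)
         | \<infinity> \<Rightarrow> B (\<epsilon> s) (\<epsilon> t) \<le> - 1)) \<and>
     (\<exists>\<chi> :: 'v \<Rightarrow> real. linear_on V \<chi> \<and> (\<forall>s\<in>S. \<chi> (\<epsilon> s) > 0))"

definition root_reflection ::
  "'v::real_vector set \<Rightarrow> ('v \<Rightarrow> 'v \<Rightarrow> real) \<Rightarrow> 'v \<Rightarrow> 'v \<Rightarrow> 'v" where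
  "root_reflection V B e = (\<lambda>x\<in>V. x - (2 * B x e) *\<^sub>R e)"

text \<open>The values of \<open>f\<close> on \<open>carrier W\<close> are determined since \<open>S\<close> generates \<open>W\<close>.\<close>

definition rooted_representation ::
  "('w, 'b) monoid_scheme \<Rightarrow> 'w set \<Rightarrow> 'v::real_vector set \<Rightarrow> ('v \<Rightarrow> 'v \<Rightarrow> real) \<Rightarrow>
   ('w \<Rightarrow> 'v) \<Rightarrow> ('w \<Rightarrow> 'v \<Rightarrow> 'v) \<Rightarrow> bool" where
  "rooted_representation W S V B \<epsilon> f \<longleftrightarrow>
     f \<in> hom W (GL V) \<and> (\<forall>s\<in>S. f s = root_reflection V B (\<epsilon> s))"

definition embeds_compatibly ::
  "('s \<Rightarrow> 's) set \<Rightarrow> 's set \<Rightarrow> 'v::real_vector set \<Rightarrow> ('v \<Rightarrow> 'v \<Rightarrow> real) \<Rightarrow>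
   ('s \<Rightarrow> 'v) \<Rightarrow> (('s \<Rightarrow> 's) \<Rightarrow> 'v \<Rightarrow> 'v) \<Rightarrow> bool" where
  "embeds_compatibly G S V B \<epsilon> \<rho> \<longleftrightarrow>
     \<rho> \<in> hom (BijGroup S\<lparr>carrier := G\<rparr>) (GL V) \<and> inj_on \<rho> G \<and>
     (\<forall>g\<in>G. \<forall>s\<in>S. \<rho> g (\<epsilon> s) = \<epsilon> (g s)) \<and>
     (\<forall>g\<in>G. \<forall>x\<in>V. \<forall>y\<in>V. B (\<rho> g x) (\<rho> g y) = B x y)"

definition fixed_vectors ::
  "'v set \<Rightarrow> 'g set \<Rightarrow> ('g \<Rightarrow> 'v \<Rightarrow> 'v) \<Rightarrow> 'v set" where
  "fixed_vectors V G \<rho> = {x \<in> V. \<forall>g\<in>G. \<rho> g x = x}"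

definition fixed_representation ::
  "'v set \<Rightarrow> 'g set \<Rightarrow> ('g \<Rightarrow> 'v \<Rightarrow> 'v) \<Rightarrow> ('w \<Rightarrow> 'v \<Rightarrow> 'v) \<Rightarrow> 'w \<Rightarrow> 'v \<Rightarrow> 'v" where
  "fixed_representation V G \<rho> f w = restrict (f w) (fixed_vectors V G \<rho>)"

section \<open>Well-definedness of the action\<close>

lemma word_eval_Nil [simp]: "word_eval W [] = \<one>\<^bsub>W\<^esub>"
  by (simp add: word_eval_def)

lemma word_eval_Cons [simp]:
  "word_eval W (a # u) = (if snd a then fst a else inv\<^bsub>W\<^esub> (fst a)) \<otimes>\<^bsub>W\<^esub> word_eval W u"
  by (simp add: word_eval_def split_beta)

lemma word_eval_closed:
  assumes "group W" "S \<subseteq> carrier W" "u \<in> words S"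
  shows "word_eval W u \<in> carrier W"
proof -
  interpret group W by fact
  show ?thesis
    using assms(3) unfolding words_def by (induction u) (use assms(2) in auto)
qed

lemma word_eval_append:
  assumes "group W" "S \<subseteq> carrier W" "u \<in> words S" "v \<in> words S"
  shows "word_eval W (u @ v) = word_eval W u \<otimes>\<^bsub>W\<^esub> word_eval W v"
proof -
  interpret group W by fact
  have v: "word_eval W v \<in> carrier W" by (rule word_eval_closed) fact+
  have *: "x \<in> words S \<Longrightarrow> word_eval W x \<in> carrier W" for x
    using word_eval_closed assms by blast
  show ?thesis using assms(3)
  proof (induction u)
    case (Cons a u)
    then have "fst a \<in> carrier W" "u \<in> words S" using assms(2) by (auto simp: words_def)
    then show ?case using Cons * v by (simp add: m_assoc)
  qed (use v in simp)
qed

lemma word_reduce_map: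
  assumes "g \<in> coxeter_symmetries S m" "word_reduce S (coxeter_relators S m) u v"
  shows "word_reduce S (coxeter_relators S m) (map (apfst g) u) (map (apfst g) v)"
  using assms(2)
proof cases
  case (cancel s x p y)
  have "g s \<in> S" using assms(1) cancel by (auto simp: coxeter_symmetries_def Bij_def bij_betw_def)
  then show ?thesis
    using word_reduce.cancel[of "g s" S "coxeter_relators S m" "map (apfst g) x" p "map (apfst g) y"]
      cancel by simp
next
  case (relator r x y)
  then obtain s t n where r: "r = concat (replicate n [(s, True), (t, True)])"
    "s \<in> S" "t \<in> S" "m s t = enat n" by (auto simp: coxeter_relators_def)
  have "map (apfst g) r = concat (replicate n [(g s, True), (g t, True)])"
    unfolding r(1) map_concat map_replicate by simp
  moreover have "g s \<in> S" "g t \<in> S" "m (g s) (g t) = enat n"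
    using assms(1) r by (auto simp: coxeter_symmetries_def Bij_def bij_betw_def)
  ultimately have "map (apfst g) r \<in> coxeter_relators S m"
    unfolding coxeter_relators_def by blast
  then show ?thesis
    using word_reduce.relator[of "map (apfst g) r" _ S "map (apfst g) x" "map (apfst g) y"] relator
    by simp
qed

lemma equivclp_word_reduce_map:
  assumes g: "g \<in> coxeter_symmetries S m" and "equivclp (word_reduce S (coxeter_relators S m)) u v"
  shows "equivclp (word_reduce S (coxeter_relators S m)) (map (apfst g) u) (map (apfst g) v)"
  using assms(2)
proof (induction rule: equivclp_induct)
  case (step y z)
  have "equivclp (word_reduce S (coxeter_relators S m)) (map (apfst g) y) (map (apfst g) z)"
    using step(2) word_reduce_map[OF g] by (meson r_into_equivclp equivclp_sym)
  with step(3) show ?case by (rule equivclp_trans)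
qed simp

lemma word_eval_hom:
  assumes W: "group W" "S \<subseteq> carrier W" and h: "h \<in> hom W W" "\<forall>s\<in>S. h s = g s"
    and u: "u \<in> words S"
  shows "h (word_eval W u) = word_eval W (map (apfst g) u)"
proof -
  interpret h: group_hom W W h
    using W h by (simp add: group_hom_def group_hom_axioms_def)
  show ?thesis using u
  proof (induction u)
    case (Cons a u)
    then have a: "fst a \<in> S" "fst a \<in> carrier W" and u: "u \<in> words S"
      using W by (auto simp: words_def)
    have "h (fst a) = g (fst a)" using a h by blast
    then show ?case
      using Cons.IH[OF u] a word_eval_closed[OF W u] by (cases "snd a") auto
  qed simp
qed

lemma ex1_symmetry_extension:
  assumes "coxeter_system W S m" and g: "g \<in> coxeter_symmetries S m"
  shows "\<exists>!\<phi>. \<phi> \<in> auto W \<and> (\<forall>s\<in>S. \<phi> s = g s)"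
proof -
  let ?g = "map (apfst g) :: 'a word \<Rightarrow> 'a word"
  let ?c = "equivclp (word_reduce S (coxeter_relators S m))"
  have W: "group W" "S \<subseteq> carrier W" and surj: "word_eval W ` words S = carrier W"
    and ev: "\<And>u v. u \<in> words S \<Longrightarrow> v \<in> words S \<Longrightarrow> word_eval W u = word_eval W v \<longleftrightarrow> ?c u v"
    using assms(1) by (auto simp: coxeter_system_def presented_by_def)
  interpret group W by (rule W)
  have gb: "bij_betw g S S" and gm: "\<And>s t. s \<in> S \<Longrightarrow> t \<in> S \<Longrightarrow> m (g s) (g t) = m s t"
    using g by (auto simp: coxeter_symmetries_def Bij_def)
  have gw: "?g u \<in> words S" if "u \<in> words S" for u
    using that gb by (fastforce simp: words_def bij_betw_def)
  define k where "k = restrict (inv_into S g) S"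
  have kS: "k s \<in> S" "g (k s) = s" if "s \<in> S" for s
    using that gb by (auto simp: k_def bij_betw_def inv_into_into f_inv_into_f)
  have kg: "k (g s) = s" if "s \<in> S" for s
    using that gb by (auto simp: k_def bij_betw_def)
  have k: "k \<in> coxeter_symmetries S m"
    unfolding coxeter_symmetries_def
    using restrict_inv_into_Bij[of g S] g gm kS
    by (auto simp: coxeter_symmetries_def k_def[symmetric]) (metis gm kS)
  let ?k = "map (apfst k) :: 'a word \<Rightarrow> 'a word"
  have kgu: "?k (?g u) = u" and gku: "?g (?k u) = u" if "u \<in> words S" for u
    using that kg kS by (auto simp: words_def intro!: map_idI)
  have kw: "?k u \<in> words S" if "u \<in> words S" for u
    using that kS by (fastforce simp: words_def)
  have inj: "word_eval W (?g u) = word_eval W (?g v) \<longleftrightarrow> word_eval W u = word_eval W v"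
    if "u \<in> words S" "v \<in> words S" for u v
  proof -
    have "?c (?g u) (?g v) \<longleftrightarrow> ?c u v"
    proof
      assume "?c (?g u) (?g v)"
      then have "?c (?k (?g u)) (?k (?g v))" by (rule equivclp_word_reduce_map[OF k])
      then show "?c u v" unfolding kgu[OF that(1)] kgu[OF that(2)] .
    qed (rule equivclp_word_reduce_map[OF g])
    then show ?thesis unfolding ev[OF gw[OF that(1)] gw[OF that(2)]] ev[OF that] .
  qed
  define w where "w x = (SOME u. u \<in> words S \<and> word_eval W u = x)" for x
  have w: "w x \<in> words S" "word_eval W (w x) = x" if "x \<in> carrier W" for x
  proof -
    from that have "x \<in> word_eval W ` words S" by (simp only: surj)
    then have "\<exists>u. u \<in> words S \<and> word_eval W u = x" by (elim imageE) (intro exI conjI, assumption, rule sym)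
    from someI_ex[OF this] show "w x \<in> words S" "word_eval W (w x) = x"
      unfolding w_def by blast+
  qed
  define \<phi> where "\<phi> = (\<lambda>x\<in>carrier W. word_eval W (?g (w x)))"
  have \<phi>: "\<phi> (word_eval W u) = word_eval W (?g u)" if u: "u \<in> words S" for u
  proof -
    have c: "word_eval W u \<in> carrier W" using W u by (rule word_eval_closed)
    then have "word_eval W (?g (w (word_eval W u))) = word_eval W (?g u)"
      using inj[OF w(1)[OF c] u] w(2)[OF c] by blast
    then show ?thesis using c by (simp add: \<phi>_def)
  qed
  have "\<phi> \<in> hom W W"
  proof (rule homI)
    fix x y assume xy: "x \<in> carrier W" "y \<in> carrier W"
    have "w x @ w y \<in> words S" using w xy by (auto simp: words_def)
    then have "\<phi> (word_eval W (w x @ w y)) = word_eval W (?g (w x @ w y))" by (rule \<phi>)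
    then show "\<phi> (x \<otimes>\<^bsub>W\<^esub> y) = \<phi> x \<otimes>\<^bsub>W\<^esub> \<phi> y"
      using xy w gw by (simp add: word_eval_append[OF W] \<phi>_def)
  qed (use w gw word_eval_closed[OF W] in \<open>auto simp: \<phi>_def\<close>)
  moreover have "bij_betw \<phi> (carrier W) (carrier W)"
  proof (rule bij_betwI')
    fix x y assume "x \<in> carrier W" "y \<in> carrier W"
    then show "(\<phi> x = \<phi> y) = (x = y)" using inj w by (simp add: \<phi>_def)
  next
    fix y assume y: "y \<in> carrier W"
    have "\<phi> (word_eval W (?k (w y))) = y" using \<phi> y w kw gku by metis
    then show "\<exists>x\<in>carrier W. y = \<phi> x" using y w kw word_eval_closed[OF W] by metis
  qed (use w gw word_eval_closed[OF W] in \<open>auto simp: \<phi>_def\<close>)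
  moreover have "\<phi> s = g s" if s: "s \<in> S" for s
  proof -
    have "g s \<in> S" using s gb by (auto simp: bij_betw_def)
    then show ?thesis using \<phi>[of "[(s, True)]"] s W(2) by (auto simp: words_def subset_iff)
  qed
  ultimately have ex: "\<phi> \<in> auto W" "\<forall>s\<in>S. \<phi> s = g s"
    by (auto simp: auto_def Bij_def \<phi>_def)
  have "\<psi> = \<phi>" if \<psi>: "\<psi> \<in> auto W" "\<forall>s\<in>S. \<psi> s = g s" for \<psi>
  proof (rule extensionalityI)
    show "\<psi> \<in> extensional (carrier W)" "\<phi> \<in> extensional (carrier W)"
      using \<psi> ex by (auto simp: auto_def Bij_def)
    fix x assume "x \<in> carrier W"
    then show "\<psi> x = \<phi> x"
      using word_eval_hom[OF W, of \<psi> g "w x"] \<phi>[of "w x"] w \<psi> by (auto simp: auto_def)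
  qed
  with ex show ?thesis by blast
qed

end

theory Submission
  imports Defs
begin

text \<open>Words in \<open>S\<close> act on \<open>V\<close> through reflections. If \<open>w s\<close> is reduced then \<open>w\<close> sends \<open>\<epsilon> s\<close> to a
  nonnegative combination of the \<open>\<epsilon> t\<close>; hence words acting alike are equivalent modulo the
  Coxeter relations, for every root basis. This gives the faithfulness of \<open>f\<close>, and it also turns a
  faithful reflection action of an arbitrary group generated by suitable elements into a
  Coxeter presentation of that group.

  For an orbit \<open>X\<close> of \<open>G\<close> on \<open>S\<close> at most one element of \<open>W\<^sub>X\<close> makes all \<open>\<epsilon> t\<close>, \<open>t \<in> X\<close>, negative;
  it is then fixed by \<open>G\<close> and acts on \<open>V\<^sup>G\<close> as the reflection in the normalised sum of the
  \<open>\<epsilon> t\<close>. These elements generate \<open>W\<^sup>G\<close>, and the angles between their roots are forced to be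
  \<open>\<pi> / n\<close> by the sign of roots. As \<open>f\<^sup>G\<close> is faithful, the presentation of \<open>W\<^sup>G\<close> follows from the
  positivity argument applied to the new root basis.\<close>

section \<open>Reflections and Chebyshev coefficients\<close>

text \<open>Two features of the setting block the usual arguments: the \<open>\<epsilon> s\<close>
  may be linearly dependent, and the form may be degenerate or indefinite. The sign of a root cannot
  be read from coordinates; it is membership in a cone, and the functional \<open>\<chi>\<close> is
  what keeps a nonzero vector and its negative from both lying there. Nor does definiteness supply a
  positive norm for orbit sums: it is extracted from the sign-reversing word, because an orbit sum
  of nonpositive norm could only be raised by the action. Arguments run on words and their action,
  and the locale for them mentions no group. They can thus be instantiated for \<open>S\<close>, for
  one or two orbits inside the same \<open>V\<close>, and for the new roots on
  \<open>V\<^sup>G\<close>, where being a Coxeter group is the conclusion. No length function on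
  \<open>W\<^sup>G\<close> has to be built. Chebyshev values enter as the coefficients of a root
  under an alternating product of two reflections. Their signs give positivity from the order
  \<open>m s t\<close> and, read backwards, force the angles of the new roots.\<close>

definition reflect :: "('v::real_vector \<Rightarrow> 'v \<Rightarrow> real) \<Rightarrow> 'v \<Rightarrow> 'v \<Rightarrow> 'v" where
  "reflect B a x = x - (2 * B x a) *\<^sub>R a"

definition act :: "('v::real_vector \<Rightarrow> 'v \<Rightarrow> real) \<Rightarrow> ('s \<Rightarrow> 'v) \<Rightarrow> 's list \<Rightarrow> 'v \<Rightarrow> 'v" where
  "act B \<epsilon> u x = foldr (\<lambda>s. reflect B (\<epsilon> s)) u x"

lemma act_simps [simp]:
  "act B \<epsilon> [] x = x"
  "act B \<epsilon> (s # u) x = reflect B (\<epsilon> s) (act B \<epsilon> u x)"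
  "act B \<epsilon> (u @ v) x = act B \<epsilon> u (act B \<epsilon> v x)"
  by (simp_all add: act_def)

section \<open>Nonnegative combinations of roots\<close>

definition pos_cone :: "('s \<Rightarrow> 'v::real_vector) \<Rightarrow> 's set \<Rightarrow> 'v set" where
  "pos_cone \<epsilon> X = {\<Sum>s\<in>X. c s *\<^sub>R \<epsilon> s | c. \<forall>s\<in>X. 0 \<le> c s}"

lemma pos_cone_add: "x \<in> pos_cone \<epsilon> X \<Longrightarrow> y \<in> pos_cone \<epsilon> X \<Longrightarrow> x + y \<in> pos_cone \<epsilon> X"
  unfolding pos_cone_def
proof clarsimp
  fix c d :: "'b \<Rightarrow> real"
  assume "\<forall>s\<in>X. 0 \<le> c s" "\<forall>s\<in>X. 0 \<le> d s"
  then show "\<exists>e. (\<Sum>s\<in>X. c s *\<^sub>R \<epsilon> s) + (\<Sum>s\<in>X. d s *\<^sub>R \<epsilon> s) = (\<Sum>s\<in>X. e s *\<^sub>R \<epsilon> s) \<and> (\<forall>s\<in>X. 0 \<le> e s)"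
    by (intro exI[of _ "\<lambda>s. c s + d s"]) (simp add: scaleR_add_left sum.distrib)
qed

lemma pos_cone_scale: "0 \<le> r \<Longrightarrow> x \<in> pos_cone \<epsilon> X \<Longrightarrow> r *\<^sub>R x \<in> pos_cone \<epsilon> X"
  unfolding pos_cone_def
proof clarsimp
  fix c :: "'b \<Rightarrow> real"
  assume "\<forall>s\<in>X. 0 \<le> c s" "0 \<le> r"
  then show "\<exists>e. r *\<^sub>R (\<Sum>s\<in>X. c s *\<^sub>R \<epsilon> s) = (\<Sum>s\<in>X. e s *\<^sub>R \<epsilon> s) \<and> (\<forall>s\<in>X. 0 \<le> e s)"
    by (intro exI[of _ "\<lambda>s. r * c s"]) (simp add: scaleR_right.sum)
qed

lemma pos_cone_zero: "0 \<in> pos_cone \<epsilon> X"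
  unfolding pos_cone_def by (rule CollectI, rule exI[of _ "\<lambda>_. 0"]) simp

lemma pos_cone_sum: "(\<And>i. i \<in> I \<Longrightarrow> x i \<in> pos_cone \<epsilon> X) \<Longrightarrow> sum x I \<in> pos_cone \<epsilon> X"
  by (induction I rule: infinite_finite_induct) (auto simp: pos_cone_zero pos_cone_add)

lemma pos_cone_generator:
  assumes "finite X" "s \<in> X" shows "\<epsilon> s \<in> pos_cone \<epsilon> X"
proof -
  have "\<epsilon> s = (\<Sum>t\<in>X. (if t = s then 1 else 0) *\<^sub>R \<epsilon> t)"
    using assms by (simp add: if_distrib[of "\<lambda>c. c *\<^sub>R _"] sum.delta cong: if_cong)
  then show ?thesis unfolding pos_cone_def by (intro CollectI exI conjI) auto
qed

text \<open>Indexed so that \<open>cheb c (Suc n)\<close> is the Chebyshev polynomial \<open>U\<^sub>n\<close> of the second kind.\<close>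

fun cheb :: "real \<Rightarrow> nat \<Rightarrow> real" where
  "cheb c 0 = 0"
| "cheb c (Suc 0) = 1"
| "cheb c (Suc (Suc n)) = 2 * c * cheb c (Suc n) - cheb c n"

text \<open>The recursion of \<open>cheb\<close> is
  \<open>sin ((n + 2) t) + sin (n t) = 2 cos t sin ((n + 1) t)\<close> divided by
  \<open>sin t\<close>; the product form avoids the division.\<close>

lemma sin_cheb: "sin t * cheb (cos t) n = sin (real n * t)"
proof (induction n rule: cheb.induct[where ?P = "\<lambda>_. _"])
  case (3 c n)
  have "sin (real (Suc (Suc n)) * t) + sin (real n * t) = 2 * sin (real (Suc n) * t) * cos t"
  proof -
    have a: "real (Suc (Suc n)) * t = real (Suc n) * t + t" "real n * t = real (Suc n) * t - t"
      by (simp_all add: algebra_simps)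
    show ?thesis unfolding a by (simp add: sin_add sin_diff)
  qed
  then show ?case using 3 by (simp add: algebra_simps)
qed simp_all

text \<open>The case of \<open>m s t = \<infinity>\<close>, where \<open>c\<close> is minus a form
  value. Monotonicity is carried along because nonnegativity alone does not survive the subtraction
  in the recursion.\<close>

lemma cheb_mono: "1 \<le> c \<Longrightarrow> 0 \<le> cheb c n \<and> cheb c n \<le> cheb c (Suc n)"
proof (induction n)
  case (Suc n)
  then have "2 * cheb c (Suc n) \<le> 2 * c * cheb c (Suc n)" by (intro mult_right_mono) auto
  then show ?case using Suc by auto
qed simp

text \<open>The angles \<open>k \<pi> / n\<close> with \<open>k \<le> n\<close> lie in
  \<open>[0, \<pi>]\<close>, where the sine is nonnegative. The bound is sharp: for
  \<open>k = n + 1\<close> the value is \<open>-1\<close>.\<close>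

lemma cheb_nonneg:
  assumes "2 \<le> n" "k \<le> n"
  shows "0 \<le> cheb (cos (pi / real n)) k"
proof -
  let ?t = "pi / real n"
  have t: "0 < ?t" "?t < pi" using assms by (auto simp: field_simps)
  then have s: "0 < sin ?t" by (rule sin_gt_zero)
  have "0 \<le> sin (real k * ?t)" using assms t
    by (intro sin_ge_zero) (auto simp: field_simps)
  then show ?thesis using sin_cheb[of ?t k] s by (metis zero_le_mult_iff less_le_not_le)
qed

section \<open>Alternating words in two letters\<close>

fun altw :: "'s \<Rightarrow> 's \<Rightarrow> nat \<Rightarrow> 's list" where
  "altw s t 0 = []"
| "altw s t (Suc k) = (if even k then t else s) # altw s t k"

lemma length_altw [simp]: "length (altw s t k) = k"
  by (induction k) auto

lemma set_altw: "set (altw s t k) \<subseteq> {s, t}"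
  by (induction k) auto

text \<open>\<open>altw\<close> grows at the front and its second argument is the last letter, the
  one that acts first; appending at the back therefore swaps the arguments.\<close>

lemma altw_snoc: "altw t s (Suc k) = altw s t k @ [s]"
  by (induction k) auto

lemma altw_double: "altw s t (2 * n) = concat (replicate n [s, t])"
  by (induction n) auto

lemma altw_add: "\<exists>p. set p \<subseteq> {s, t} \<and> length p = j \<and> altw s t (j + k) = p @ altw s t k"
proof (induction j)
  case (Suc j)
  then obtain p where "set p \<subseteq> {s, t}" "length p = j" "altw s t (j + k) = p @ altw s t k" by blast
  then show ?case
    by (intro exI[of _ "(if even (j + k) then t else s) # p"]) auto
qed simp

lemma altw_unique:
  "set y \<subseteq> {s, t} \<Longrightarrow> s \<noteq> t \<Longrightarrow> distinct_adj y \<Longrightarrow> y \<noteq> [] \<Longrightarrow> last y = t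
   \<Longrightarrow> y = altw s t (length y)"
proof (induction y rule: induct_list012)
  case (3 x x' y)
  then have IH: "x' # y = altw s t (length (x' # y))" by auto
  then have "x' = (if even (length y) then t else s)" by simp
  then have "x = (if even (Suc (length y)) then t else s)" using 3(3-5) by auto
  then show ?case using IH by simp
qed auto

section \<open>Bilinear forms and products of two reflections\<close>

locale form_space =
  fixes V :: "'v::real_vector set" and B :: "'v \<Rightarrow> 'v \<Rightarrow> real"
  assumes subspace_V: "subspace V" and bilin: "symmetric_bilinear_on V B"
begin

lemmas V_closed [simp] = subspace_0[OF subspace_V] subspace_add[OF subspace_V]
  subspace_diff[OF subspace_V] subspace_scale[OF subspace_V] subspace_neg[OF subspace_V]

lemma V_sum [simp]: "(\<And>i. i \<in> I \<Longrightarrow> x i \<in> V) \<Longrightarrow> sum x I \<in> V"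
  by (rule subspace_sum[OF subspace_V])

lemma B_sym: "x \<in> V \<Longrightarrow> y \<in> V \<Longrightarrow> B x y = B y x"
  using bilin by (auto simp: symmetric_bilinear_on_def)

lemma B_add_right: "x \<in> V \<Longrightarrow> y \<in> V \<Longrightarrow> z \<in> V \<Longrightarrow> B x (y + z) = B x y + B x z"
  and B_scale_right: "x \<in> V \<Longrightarrow> y \<in> V \<Longrightarrow> B x (c *\<^sub>R y) = c * B x y"
  and B_add_left: "x \<in> V \<Longrightarrow> y \<in> V \<Longrightarrow> z \<in> V \<Longrightarrow> B (y + z) x = B y x + B z x"
  and B_scale_left: "x \<in> V \<Longrightarrow> y \<in> V \<Longrightarrow> B (c *\<^sub>R y) x = c * B y x"
  using bilin by (auto simp: symmetric_bilinear_on_def linear_on_def)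

lemma B_minus_right: "x \<in> V \<Longrightarrow> y \<in> V \<Longrightarrow> B x (- y) = - B x y"
  and B_minus_left: "x \<in> V \<Longrightarrow> y \<in> V \<Longrightarrow> B (- y) x = - B y x"
  using B_scale_right[of x y "-1"] B_scale_left[of x y "-1"] by simp_all

lemma B_diff_right: "x \<in> V \<Longrightarrow> y \<in> V \<Longrightarrow> z \<in> V \<Longrightarrow> B x (y - z) = B x y - B x z"
  and B_diff_left: "x \<in> V \<Longrightarrow> y \<in> V \<Longrightarrow> z \<in> V \<Longrightarrow> B (y - z) x = B y x - B z x"
  using B_add_right[of x y "-z"] B_add_left[of x y "-z"] by (simp_all add: B_minus_right B_minus_left)

lemma B_zero: "x \<in> V \<Longrightarrow> B x 0 = 0" "x \<in> V \<Longrightarrow> B 0 x = 0"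
  using B_scale_right[of x 0 0] B_scale_left[of x 0 0] by auto

lemmas B_simps = B_add_right B_add_left B_scale_right B_scale_left B_minus_right B_minus_left
  B_diff_right B_diff_left B_zero

lemma B_sum_right: "x \<in> V \<Longrightarrow> (\<And>i. i \<in> I \<Longrightarrow> y i \<in> V) \<Longrightarrow> B x (sum y I) = (\<Sum>i\<in>I. B x (y i))"
  by (induction I rule: infinite_finite_induct) (auto simp: B_simps)

lemma B_sum_left: "x \<in> V \<Longrightarrow> (\<And>i. i \<in> I \<Longrightarrow> y i \<in> V) \<Longrightarrow> B (sum y I) x = (\<Sum>i\<in>I. B (y i) x)"
  by (induction I rule: infinite_finite_induct) (auto simp: B_simps)

lemma reflect_V [simp]: "a \<in> V \<Longrightarrow> x \<in> V \<Longrightarrow> reflect B a x \<in> V"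
  by (simp add: reflect_def)

lemma reflect_add: "a \<in> V \<Longrightarrow> x \<in> V \<Longrightarrow> y \<in> V \<Longrightarrow> reflect B a (x + y) = reflect B a x + reflect B a y"
  by (simp add: reflect_def B_simps algebra_simps)

lemma reflect_scale: "a \<in> V \<Longrightarrow> x \<in> V \<Longrightarrow> reflect B a (c *\<^sub>R x) = c *\<^sub>R reflect B a x"
  by (simp add: reflect_def B_simps algebra_simps)

lemma reflect_involution: "a \<in> V \<Longrightarrow> B a a = 1 \<Longrightarrow> x \<in> V \<Longrightarrow> reflect B a (reflect B a x) = x"
  by (simp add: reflect_def B_simps)

lemma reflect_isometry:
  "a \<in> V \<Longrightarrow> B a a = 1 \<Longrightarrow> x \<in> V \<Longrightarrow> y \<in> V \<Longrightarrow> B (reflect B a x) (reflect B a y) = B x y"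
  using B_sym[of a y] by (simp add: reflect_def B_simps algebra_simps)

text \<open>One step of the recursion of \<open>cheb\<close> at \<open>- B a b\<close>.\<close>

lemma reflect_pair:
  assumes "a \<in> V" "b \<in> V" "B a a = 1" "B b b = 1"
  shows "reflect B b (p *\<^sub>R a + q *\<^sub>R b) = p *\<^sub>R a + (2 * (- B a b) * p - q) *\<^sub>R b"
proof -
  have "B (p *\<^sub>R a + q *\<^sub>R b) b = p * B a b + q" using assms by (simp add: B_simps)
  then have "reflect B b (p *\<^sub>R a + q *\<^sub>R b) = p *\<^sub>R a + (q - 2 * (p * B a b + q)) *\<^sub>R b"
    unfolding reflect_def by (simp only: scaleR_diff_left add_diff_eq)
  also have "q - 2 * (p * B a b + q) = 2 * (- B a b) * p - q" by (simp add: algebra_simps)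
  finally show ?thesis .
qed

text \<open>Each reflection updates one of the two coefficients, so they are always consecutive
  Chebyshev values; the parity of \<open>k\<close> tells which root carries the newer one.\<close>

lemma act_altw:
  assumes "\<epsilon> s \<in> V" "\<epsilon> t \<in> V" "B (\<epsilon> s) (\<epsilon> s) = 1" "B (\<epsilon> t) (\<epsilon> t) = 1"
  defines "U \<equiv> cheb (- B (\<epsilon> s) (\<epsilon> t))"
  shows "act B \<epsilon> (altw s t k) (\<epsilon> s) =
    (if even k then U (Suc k) *\<^sub>R \<epsilon> s + U k *\<^sub>R \<epsilon> t else U k *\<^sub>R \<epsilon> s + U (Suc k) *\<^sub>R \<epsilon> t)"
proof (induction k)
  case (Suc k)
  show ?case
  proof (cases "even k")
    case True
    then show ?thesis using Suc reflect_pair[OF assms(1-4)] by (simp add: U_def)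
  next
    case False
    then show ?thesis using Suc reflect_pair[OF assms(2,1,4,3), of "U (Suc k)" "U k"] B_sym[OF assms(1,2)]
      by (simp add: U_def add.commute[of _ "_ *\<^sub>R \<epsilon> t"])
  qed
qed (simp add: U_def)

text \<open>On the plane spanned by \<open>a\<close> and \<open>b\<close> the product of the two reflections is a rotation
  by \<open>2 \<pi> / n\<close>; it is the identity on the orthogonal complement.\<close>

lemma reflect_braid:
  assumes a: "a \<in> V" "B a a = 1" and b: "b \<in> V" "B b b = 1"
    and n: "2 \<le> n" and ab: "B a b = - cos (pi / real n)" and x: "x \<in> V"
  shows "((\<lambda>x. reflect B a (reflect B b x)) ^^ n) x = x"
proof -
  let ?T = "\<lambda>x. reflect B a (reflect B b x)"
  define t where "t = pi / real n"
  define U where "U = cheb (cos t)"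
  have ab': "- B a b = cos t" "- B b a = cos t" "B a b = - cos t" "B b a = - cos t" using ab B_sym a b by (auto simp: t_def)
  have t: "0 < t" "t < pi" using n by (auto simp: t_def field_simps)
  then have s: "0 < sin t" by (rule sin_gt_zero)
  have U: "sin t * U k = sin (real k * t)" for k by (simp add: U_def sin_cheb)
  have nt: "real n * t = pi" using n by (simp add: t_def)
  have step: "?T (U (Suc j) *\<^sub>R a + U j *\<^sub>R b) = U (Suc (Suc (Suc j))) *\<^sub>R a + U (Suc (Suc j)) *\<^sub>R b" for j
  proof -
    have "reflect B b (U (Suc j) *\<^sub>R a + U j *\<^sub>R b) = U (Suc (Suc j)) *\<^sub>R b + U (Suc j) *\<^sub>R a"
      using reflect_pair[OF a(1) b(1) a(2) b(2), of "U (Suc j)" "U j"] ab'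
      by (simp add: U_def add.commute[of _ "_ *\<^sub>R a"])
    then show ?thesis
      using reflect_pair[OF b(1) a(1) b(2) a(2), of "U (Suc (Suc j))" "U (Suc j)"] ab'
      by (simp add: U_def add.commute[of _ "_ *\<^sub>R a"])
  qed
  have Tk: "(?T ^^ k) (U (Suc j) *\<^sub>R a + U j *\<^sub>R b) = U (Suc (j + 2 * k)) *\<^sub>R a + U (j + 2 * k) *\<^sub>R b" for k j
  proof (induction k)
    case (Suc k)
    then show ?case using step[of "j + 2 * k"] by simp
  qed simp
  have TV: "y \<in> V \<Longrightarrow> (?T ^^ k) y \<in> V" for k y by (induction k) (use a b in auto)
  have Tadd: "(?T ^^ k) (y + z) = (?T ^^ k) y + (?T ^^ k) z" if "y \<in> V" "z \<in> V" for k y z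
    by (induction k) (use a b that TV in \<open>simp_all add: reflect_add\<close>)
  have Tscale: "(?T ^^ k) (c *\<^sub>R y) = c *\<^sub>R (?T ^^ k) y" if "y \<in> V" for k c y
    by (induction k) (use a b that TV in \<open>simp_all add: reflect_scale\<close>)
  have per: "U (k + 2 * n) = U k" for k
  proof -
    have e: "real (k + 2 * n) * t = real k * t + 2 * pi" using nt by (simp add: algebra_simps)
    have "sin t * U (k + 2 * n) = sin t * U k" unfolding U e by simp
    then show ?thesis using s by simp
  qed
  have U0: "U 0 = 0" "U (Suc 0) = 1" "U (Suc (Suc 0)) = 2 * cos t" by (simp_all add: U_def)
  have Ta: "(?T ^^ n) a = a" using Tk[of n 0] per[of 0] per[of 1] U0 by simp
  have Tb: "(?T ^^ n) b = b"
  proof -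
    have "(?T ^^ n) (U 2 *\<^sub>R a + U (Suc 0) *\<^sub>R b) = U 2 *\<^sub>R a + U (Suc 0) *\<^sub>R b"
      using Tk[of n "Suc 0"] per[of 1] per[of 2] by (simp add: numeral_2_eq_2)
    then show ?thesis using Ta a b U0 by (simp add: Tadd Tscale)
  qed
  \<comment> \<open>\<open>D\<close> is the Gram determinant of \<open>a\<close> and
    \<open>b\<close>, and \<open>p\<close>, \<open>q\<close> are the coordinates of the orthogonal
    projection of \<open>x\<close> to their plane. The rest \<open>y\<close> is fixed by both
    reflections.\<close>
  define D where "D = 1 - (cos t)\<^sup>2"
  have D: "D \<noteq> 0" using s sin_squared_eq[of t] by (auto simp: D_def)
  define p where "p = (B x a + cos t * B x b) / D"
  define q where "q = (B x b + cos t * B x a) / D"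
  define y where "y = x - (p *\<^sub>R a + q *\<^sub>R b)"
  have yV: "y \<in> V" using a b x by (simp add: y_def)
  have "B y a = B x a - (p - cos t * q)" "B y b = B x b - (q - cos t * p)"
    using a b x ab' by (simp_all add: y_def B_simps)
  moreover have "p - cos t * q = (B x a * D) / D" "q - cos t * p = (B x b * D) / D"
    unfolding p_def q_def times_divide_eq_right diff_divide_distrib[symmetric]
    by (simp_all add: D_def power2_eq_square algebra_simps)
  ultimately have "B y a = 0" "B y b = 0" using D by simp_all
  then have "?T y = y" by (simp add: reflect_def)
  then have "(?T ^^ n) y = y" by (induction n) auto
  then have "(?T ^^ n) (y + (p *\<^sub>R a + q *\<^sub>R b)) = y + (p *\<^sub>R a + q *\<^sub>R b)"
    using Ta Tb a b yV by (simp add: Tadd Tscale)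
  then show ?thesis by (simp add: y_def)
qed

end

section \<open>Positivity and faithfulness\<close>

lemma equivclp_invariant:
  assumes "equivclp r u v" "\<And>u v. r u v \<Longrightarrow> F u = F v"
  shows "F u = F v"
  using assms(1) by (induction rule: equivclp_induct) (use assms(2) in fastforce)+

definition letters :: "'s list \<Rightarrow> 's word" where
  "letters u = map (\<lambda>s. (s, True)) u"

lemma letters_simps [simp]:
  "letters [] = []" "letters (s # u) = (s, True) # letters u" "letters (u @ v) = letters u @ letters v"
  "map fst (letters u) = u" "letters u \<in> words S \<longleftrightarrow> u \<in> lists S" "length (letters u) = length u"
  by (auto simp: letters_def words_def comp_def)

lemma words_iff_map_fst: "u \<in> words S \<longleftrightarrow> map fst u \<in> lists S"
  by (induction u) (auto simp: words_def)

definition cox_equiv :: "'s set \<Rightarrow> ('s \<Rightarrow> 's \<Rightarrow> enat) \<Rightarrow> 's list \<Rightarrow> 's list \<Rightarrow> bool" where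
  "cox_equiv S m u v \<longleftrightarrow> equivclp (word_reduce S (coxeter_relators S m)) (letters u) (letters v)"

lemma word_reduce_context:
  assumes "word_reduce S R u v" shows "word_reduce S R (x @ u @ y) (x @ v @ y)"
  using assms
proof cases
  case (cancel s a p b)
  then show ?thesis using word_reduce.cancel[of s S R "x @ a" p "b @ y"] by simp
next
  case (relator r a b)
  then show ?thesis using word_reduce.relator[of r R S "x @ a" "b @ y"] by simp
qed

lemma equivclp_word_reduce_context:
  assumes "equivclp (word_reduce S R) u v"
  shows "equivclp (word_reduce S R) (x @ u @ y) (x @ v @ y)"
  using assms
proof (induction rule: equivclp_induct)
  case (step v w)
  have "equivclp (word_reduce S R) (x @ v @ y) (x @ w @ y)"
    using step(2) word_reduce_context by (metis r_into_equivclp equivclp_sym)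
  then show ?case using step(3) equivclp_trans by metis
qed simp

lemma cox_equiv_refl [simp]: "cox_equiv S m u u"
  by (simp add: cox_equiv_def)

lemma cox_equiv_sym: "cox_equiv S m u v \<Longrightarrow> cox_equiv S m v u"
  unfolding cox_equiv_def by (rule equivclp_sym)

lemma cox_equiv_trans [trans]: "cox_equiv S m u v \<Longrightarrow> cox_equiv S m v w \<Longrightarrow> cox_equiv S m u w"
  unfolding cox_equiv_def by (rule equivclp_trans)

lemma cox_equiv_context: "cox_equiv S m u v \<Longrightarrow> cox_equiv S m (x @ u @ y) (x @ v @ y)"
  unfolding cox_equiv_def using equivclp_word_reduce_context by fastforce

lemma cox_equiv_append:
  assumes "cox_equiv S m u u'" "cox_equiv S m v v'" shows "cox_equiv S m (u @ v) (u' @ v')"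
  using cox_equiv_context[OF assms(1), of "[]" v] cox_equiv_context[OF assms(2), of u' "[]"]
  by (simp add: cox_equiv_trans)

lemma cox_equiv_relator:
  assumes "s \<in> S" "t \<in> S" "m s t = enat n"
  shows "cox_equiv S m (concat (replicate n [s, t])) []"
proof -
  have "letters (concat (replicate n [s, t])) = concat (replicate n [(s, True), (t, True)])"
    by (simp add: letters_def map_concat map_replicate)
  moreover have "concat (replicate n [(s, True), (t, True)]) \<in> coxeter_relators S m"
    using assms unfolding coxeter_relators_def by blast
  ultimately show ?thesis
    using word_reduce.relator[of _ "coxeter_relators S m" S "[]" "[]"]
    by (metis cox_equiv_def append_Nil append_Nil2 letters_simps(1) r_into_equivclp)
qed

lemma cox_equiv_square:
  assumes "coxeter_matrix S m" "s \<in> S" shows "cox_equiv S m [s, s] []"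
  using cox_equiv_relator[of s S s m 1] assms by (simp add: coxeter_matrix_def one_enat_def)

lemma cox_equiv_rev:
  assumes "coxeter_matrix S m" "u \<in> lists S" shows "cox_equiv S m (rev u @ u) []"
  using assms(2)
proof (induction u)
  case (Cons s u)
  have "cox_equiv S m (rev u @ [s, s] @ u) (rev u @ [] @ u)"
    using Cons cox_equiv_context cox_equiv_square[OF assms(1)] by blast
  then show ?case using Cons by (auto intro: cox_equiv_trans)
qed simp

lemma word_equiv_letters:
  assumes cm: "coxeter_matrix S m" and u: "u \<in> words S"
  shows "equivclp (word_reduce S (coxeter_relators S m)) u (letters (map fst u))"
  using u
proof (induction u)
  case (Cons a u)
  let ?c = "equivclp (word_reduce S (coxeter_relators S m))"
  obtain s p where a: "a = (s, p)" by (cases a)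
  have s: "s \<in> S" and u: "u \<in> words S" using Cons.prems a by (auto simp: words_def)
  have "?c [a] [(s, True)]"
  proof (cases p)
    case False
    have "?c ([(s, False)] @ [(s, True), (s, True)] @ []) ([(s, False)] @ [] @ [])"
      by (rule equivclp_word_reduce_context)
        (use cox_equiv_square[OF cm s] in \<open>simp add: cox_equiv_def\<close>)
    moreover have "?c [(s, False), (s, True), (s, True)] [(s, True)]"
      using word_reduce.cancel[OF s, of "coxeter_relators S m" "[]" False "[(s, True)]"] by auto
    ultimately show ?thesis using a False by (simp add: equivclp_sym) (metis equivclp_sym equivclp_trans)
  qed (simp add: a)
  then have "?c ([] @ [a] @ u) ([] @ [(s, True)] @ u)" by (rule equivclp_word_reduce_context)
  moreover have "?c ([(s, True)] @ u @ []) ([(s, True)] @ letters (map fst u) @ [])"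
    using Cons.IH[OF u] by (rule equivclp_word_reduce_context)
  ultimately show ?case using a by simp (metis equivclp_trans)
qed simp

section \<open>The action of words on a root basis\<close>

locale root_system =
  fixes S :: "'s set" and m :: "'s \<Rightarrow> 's \<Rightarrow> enat" and V :: "'v::real_vector set"
    and B :: "'v \<Rightarrow> 'v \<Rightarrow> real" and \<epsilon> :: "'s \<Rightarrow> 'v"
  assumes finite_S: "finite S" and cox_matrix: "coxeter_matrix S m"
    and root_basis: "root_basis S m V B \<epsilon>"

sublocale root_system \<subseteq> form_space V B
  using root_basis by unfold_locales (auto simp: root_basis_def fin_dim_subspace_def)

context root_system
begin

abbreviation ceq (infix \<open>\<approx>\<close> 50) where "u \<approx> v \<equiv> cox_equiv S m u v"

abbreviation ac where "ac \<equiv> act B \<epsilon>"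

lemma root_in_V [simp]: "s \<in> S \<Longrightarrow> \<epsilon> s \<in> V"
  and root_unit [simp]: "s \<in> S \<Longrightarrow> B (\<epsilon> s) (\<epsilon> s) = 1"
  and root_finite: "s \<in> S \<Longrightarrow> t \<in> S \<Longrightarrow> s \<noteq> t \<Longrightarrow> m s t = enat n \<Longrightarrow> B (\<epsilon> s) (\<epsilon> t) = - cos (pi / real n)"
  and root_infinite: "s \<in> S \<Longrightarrow> t \<in> S \<Longrightarrow> s \<noteq> t \<Longrightarrow> m s t = \<infinity> \<Longrightarrow> B (\<epsilon> s) (\<epsilon> t) \<le> -1"
  using root_basis unfolding root_basis_def by fastforce+

lemma order_ge2:
  assumes "s \<in> S" "t \<in> S" "s \<noteq> t" "m s t = enat n" shows "2 \<le> n"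
proof -
  have "2 \<le> enat n" using cox_matrix assms unfolding coxeter_matrix_def by metis
  then show ?thesis by (simp add: numeral_eq_enat)
qed

lemma root_form_nonpos:
  assumes "s \<in> S" "t \<in> S" "s \<noteq> t" shows "B (\<epsilon> s) (\<epsilon> t) \<le> 0"
proof (cases "m s t")
  case (enat n)
  have "2 \<le> n" using order_ge2 assms enat by blast
  then have "pi / real n \<le> pi / 2" by (intro divide_left_mono) auto
  moreover have "- (pi / 2) \<le> pi / real n"
    by (rule order_trans[of _ 0]) auto
  ultimately have "0 \<le> cos (pi / real n)" by (intro cos_ge_zero)
  then show ?thesis using root_finite assms enat by simp
next
  case infinity
  then show ?thesis using root_infinite[OF assms] by simp
qed

lemma root_cheb_nonneg:
  assumes "s \<in> S" "t \<in> S" "s \<noteq> t" "\<And>n. m s t = enat n \<Longrightarrow> k \<le> n"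
  shows "0 \<le> cheb (- B (\<epsilon> s) (\<epsilon> t)) k"
proof (cases "m s t")
  case (enat n)
  then show ?thesis using cheb_nonneg[of n k] order_ge2 root_finite assms by simp
next
  case infinity
  then show ?thesis using cheb_mono root_infinite[OF assms(1-3)] by simp
qed

lemma ac_V [simp]: "u \<in> lists S \<Longrightarrow> x \<in> V \<Longrightarrow> ac u x \<in> V"
  by (induction u) auto

lemma ac_add: "u \<in> lists S \<Longrightarrow> x \<in> V \<Longrightarrow> y \<in> V \<Longrightarrow> ac u (x + y) = ac u x + ac u y"
  by (induction u) (auto simp: reflect_add)

lemma ac_scale: "u \<in> lists S \<Longrightarrow> x \<in> V \<Longrightarrow> ac u (c *\<^sub>R x) = c *\<^sub>R ac u x"
  by (induction u) (auto simp: reflect_scale)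

lemma ac_minus: "u \<in> lists S \<Longrightarrow> x \<in> V \<Longrightarrow> ac u (- x) = - ac u x"
  using ac_scale[of u x "-1"] by simp

lemma ac_sum:
  "u \<in> lists S \<Longrightarrow> (\<And>i. i \<in> I \<Longrightarrow> x i \<in> V) \<Longrightarrow> ac u (sum x I) = (\<Sum>i\<in>I. ac u (x i))"
  using ac_scale[of u 0 0] by (induction I rule: infinite_finite_induct) (auto simp: ac_add)

lemma ac_isometry: "u \<in> lists S \<Longrightarrow> x \<in> V \<Longrightarrow> y \<in> V \<Longrightarrow> B (ac u x) (ac u y) = B x y"
  by (induction u) (auto simp: reflect_isometry)

lemma ac_rev: "u \<in> lists S \<Longrightarrow> x \<in> V \<Longrightarrow> ac (rev u) (ac u x) = x"
proof (induction u arbitrary: x)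
  case (Cons s u)
  then show ?case by (simp add: reflect_involution)
qed simp

lemma ac_relator:
  assumes s: "s \<in> S" "t \<in> S" "m s t = enat n" and x: "x \<in> V"
  shows "ac (concat (replicate n [s, t])) x = x"
proof -
  have eq: "ac (concat (replicate k [s, t])) x
      = ((\<lambda>x. reflect B (\<epsilon> s) (reflect B (\<epsilon> t) x)) ^^ k) x" for k
    by (induction k) auto
  show ?thesis
  proof (cases "s = t")
    case True
    then have "n = 1" using cox_matrix s by (auto simp: coxeter_matrix_def one_enat_def)
    then show ?thesis using eq[of 1] True s x by (simp add: reflect_involution)
  next
    case False
    then show ?thesis unfolding eq
      using reflect_braid[of "\<epsilon> s" "\<epsilon> t" n x] order_ge2 root_finite s x by simp
  qed
qed

lemma word_reduce_act:
  assumes "word_reduce S (coxeter_relators S m) u v" "u \<in> words S" "x \<in> V"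
  shows "ac (map fst u) x = ac (map fst v) x"
  using assms(1)
proof cases
  case (cancel s a p b)
  then have "map fst b \<in> lists S" using assms(2) by (simp add: words_iff_map_fst)
  then show ?thesis using cancel assms(3) by (simp add: reflect_involution)
next
  case (relator r a b)
  then have "map fst b \<in> lists S" using assms(2) by (simp add: words_iff_map_fst)
  moreover obtain s t n where r: "r = concat (replicate n [(s, True), (t, True)])"
    "s \<in> S" "t \<in> S" "m s t = enat n" using relator(3) by (auto simp: coxeter_relators_def)
  moreover have "map fst r = concat (replicate n [s, t])"
    unfolding r(1) by (simp add: map_concat map_replicate)
  ultimately show ?thesis using relator assms(3) ac_relator by simp
qed

lemma word_reduce_parity:
  assumes "word_reduce S (coxeter_relators S m) u v"
  shows "even (length u) = even (length v)"
  using assms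
proof cases
  case (relator r a b)
  then obtain s t n where r: "r = concat (replicate n [(s, True), (t, True)])"
    by (auto simp: coxeter_relators_def)
  have "even (length r)" unfolding r by (induction n) auto
  then show ?thesis using relator by simp
qed simp

lemma word_reduce_words:
  assumes "word_reduce S (coxeter_relators S m) u v"
  shows "u \<in> words S \<longleftrightarrow> v \<in> words S"
  using assms
proof cases
  case (relator r a b)
  then obtain s t n where r: "r = concat (replicate n [(s, True), (t, True)])" "s \<in> S" "t \<in> S"
    by (auto simp: coxeter_relators_def)
  have "r \<in> words S" unfolding r(1) words_def using r(2,3) by (induction n) auto
  then show ?thesis using relator by (auto simp: words_def)
qed (auto simp: words_def)

text \<open>Parity of the length is the sign character. It forces the minimal lengths for
  \<open>w\<close> and \<open>w s\<close> to differ.\<close>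

lemma ceq_parity: "u \<approx> v \<Longrightarrow> even (length u) = even (length v)"
  unfolding cox_equiv_def
  using equivclp_invariant[of _ _ _ "\<lambda>u. even (length u)"] word_reduce_parity by fastforce

lemma ceq_lists: "u \<approx> v \<Longrightarrow> u \<in> lists S \<longleftrightarrow> v \<in> lists S"
  unfolding cox_equiv_def
  using equivclp_invariant[of _ _ _ "\<lambda>u. u \<in> words S"] word_reduce_words by fastforce

lemma word_equiv_act:
  assumes "equivclp (word_reduce S (coxeter_relators S m)) u v" "u \<in> words S" "x \<in> V"
  shows "ac (map fst u) x = ac (map fst v) x"
proof -
  \<comment> \<open>The value \<open>None\<close> outside \<open>words S\<close> makes
    \<open>F\<close> invariant under every single reduction, so the induction over the equivalence
    need not carry membership in \<open>words S\<close>.\<close>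
  define F where "F u = (if u \<in> words S then Some (ac (map fst u) x) else None)" for u
  have "F u = F v"
    by (rule equivclp_invariant[OF assms(1)])
      (auto simp: F_def word_reduce_words word_reduce_act[OF _ _ assms(3)])
  then show ?thesis using assms(2) by (auto simp: F_def split: if_splits)
qed

lemma ceq_act: "u \<approx> v \<Longrightarrow> u \<in> lists S \<Longrightarrow> x \<in> V \<Longrightarrow> ac u x = ac v x"
  unfolding cox_equiv_def using word_equiv_act[of "letters u" "letters v" x] by simp

section \<open>Reduced words and minimal coset representatives\<close>

definition reduced :: "'s list \<Rightarrow> bool" where
  "reduced u \<longleftrightarrow> u \<in> lists S \<and> (\<forall>v. u \<approx> v \<longrightarrow> length u \<le> length v)"

lemma reduced_lists: "reduced u \<Longrightarrow> u \<in> lists S"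
  by (simp add: reduced_def)

lemma reduced_cong: "reduced u \<Longrightarrow> u \<approx> v \<Longrightarrow> length v \<le> length u \<Longrightarrow> reduced v"
  unfolding reduced_def using ceq_lists cox_equiv_trans le_trans by metis

lemma reduced_exists:
  assumes "u \<in> lists S" shows "\<exists>v. u \<approx> v \<and> reduced v"
proof -
  obtain v where v: "u \<approx> v" "\<And>w. u \<approx> w \<Longrightarrow> length v \<le> length w"
    using ex_has_least_nat[of "\<lambda>v. u \<approx> v" u length] by auto
  then show ?thesis unfolding reduced_def using assms ceq_lists cox_equiv_trans by metis
qed

lemma reduced_infix:
  assumes "reduced (x @ u @ y)" shows "reduced u"
  unfolding reduced_def
proof (intro conjI allI impI)
  show "u \<in> lists S" using assms by (auto simp: reduced_def)
  fix v assume "u \<approx> v"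
  then have "x @ u @ y \<approx> x @ v @ y" by (rule cox_equiv_context)
  then show "length u \<le> length v" using assms unfolding reduced_def by fastforce
qed

lemma reduced_prefix: "reduced (u @ y) \<Longrightarrow> reduced u"
  using reduced_infix[of "[]" u y] by simp

lemma reduced_suffix: "reduced (x @ u) \<Longrightarrow> reduced u"
  using reduced_infix[of x u "[]"] by simp

text \<open>Some \<open>v\<close> shorter than \<open>w s\<close> represents it; parity excludes the
  length of \<open>w\<close>, so \<open>v\<close> is shorter than \<open>w\<close>, and appending
  \<open>s\<close> recovers \<open>w\<close>.\<close>

lemma exchange_snoc:
  assumes w: "reduced w" and s: "s \<in> S" and nr: "\<not> reduced (w @ [s])"
  obtains v where "reduced (v @ [s])" "w \<approx> v @ [s]" "length w = Suc (length v)"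
proof -
  obtain v where v: "w @ [s] \<approx> v" "length v < Suc (length w)"
    using nr w s unfolding reduced_def by (auto simp: not_le)
  have "length v \<noteq> length w" using ceq_parity[OF v(1)] by auto
  then have len: "Suc (length v) \<le> length w" using v(2) by simp
  have "w @ [] \<approx> w @ [s, s]"
    by (rule cox_equiv_append) (auto intro: cox_equiv_sym cox_equiv_square[OF cox_matrix s])
  also have "w @ [s, s] \<approx> v @ [s]" using cox_equiv_append[OF v(1), of "[s]" "[s]"] by simp
  finally have c: "w \<approx> v @ [s]" by simp
  then have "length w = Suc (length v)" using w len by (fastforce simp: reduced_def)
  then show ?thesis using that c reduced_cong[OF w c] by simp
qed

text \<open>Among the splittings with additive lengths and right factor over \<open>X\<close>, take
  the shortest left factor: if \<open>v t\<close> were not reduced, a letter \<open>t\<close> could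
  be moved from \<open>v\<close> to the right factor.\<close>

lemma min_coset_decomposition:
  assumes w: "reduced (x @ y)" and X: "X \<subseteq> S" "y \<in> lists X"
  obtains v z where "x @ y \<approx> v @ z" "z \<in> lists X" "length (x @ y) = length v + length z"
    "length v \<le> length x" "reduced (v @ z)" "\<And>t. t \<in> X \<Longrightarrow> reduced (v @ [t])"
proof -
  define P where "P v z \<longleftrightarrow> x @ y \<approx> v @ z \<and> z \<in> lists X \<and> length (x @ y) = length v + length z" for v z
  have "P x y" using X by (simp add: P_def)
  then have "\<exists>z. P x z" ..
  then obtain v where v: "\<exists>z. P v z" "\<And>v'. \<exists>z. P v' z \<Longrightarrow> length v \<le> length v'"
    using ex_has_least_nat[of "\<lambda>v. \<exists>z. P v z" x length] by auto
  then obtain z where z: "x @ y \<approx> v @ z" "z \<in> lists X" "length (x @ y) = length v + length z"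
    by (auto simp: P_def)
  have vz: "reduced (v @ z)" using reduced_cong[OF w z(1)] z(3) by simp
  have vt: "reduced (v @ [t])" if t: "t \<in> X" for t
  proof (rule ccontr)
    assume "\<not> reduced (v @ [t])"
    then obtain v' where v': "v \<approx> v' @ [t]" "length v = Suc (length v')"
      using exchange_snoc[OF reduced_prefix[OF vz]] t X by blast
    have "x @ y \<approx> v' @ t # z"
      using z(1) cox_equiv_append[OF v'(1), of z z] cox_equiv_trans by fastforce
    then have "P v' (t # z)" using z v' t by (simp add: P_def)
    then show False using v(2)[of v'] v'(2) by auto
  qed
  have "length v \<le> length x" using v(2)[of x] \<open>\<exists>z. P x z\<close> by blast
  then show ?thesis using that z vz vt by blast
qed

lemma reduced_distinct_adj: "reduced u \<Longrightarrow> distinct_adj u"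
proof (induction u rule: induct_list012)
  case (3 s t u)
  have "reduced (t # u)" using reduced_suffix[of "[s]" "t # u"] 3(3) by simp
  moreover have "s \<noteq> t"
  proof
    assume "s = t"
    then have "reduced [s, s]" using reduced_prefix[of "[s, s]" u] 3(3) by simp
    then show False using cox_equiv_square[OF cox_matrix, of s] by (force simp: reduced_def)
  qed
  ultimately show ?case using 3 by simp
qed auto

text \<open>By the relator of length \<open>2 n\<close>, the alternating word with
  \<open>n + 1\<close> letters is equivalent to the inverse of the remaining \<open>n - 1\<close>
  letters.\<close>

lemma reduced_altw_length:
  assumes s: "s \<in> S" "t \<in> S" "s \<noteq> t" "m s t = enat n" and red: "reduced (altw s t k)"
  shows "k \<le> n"
proof (rule ccontr)
  assume "\<not> k \<le> n"
  then have "\<exists>p. altw s t k = p @ altw s t (Suc n)"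
    using altw_add[of s t "k - Suc n" "Suc n"] by auto
  then have r: "reduced (altw s t (Suc n))" using red reduced_suffix by metis
  have n: "2 \<le> n" using order_ge2 s by blast
  then have "n - 1 + Suc n = 2 * n" by simp
  then obtain p where p: "set p \<subseteq> {s, t}" "length p = n - 1" "altw s t (2 * n) = p @ altw s t (Suc n)"
    using altw_add[of s t "n - 1" "Suc n"] by metis
  then have pl: "p \<in> lists S" using s by (auto simp: in_lists_conv_set)
  have "p @ altw s t (Suc n) \<approx> []" using p
    cox_equiv_relator[where m = m, OF s(1,2,4)] by (simp add: altw_double)
  then have "rev p @ p @ altw s t (Suc n) \<approx> rev p"
    using cox_equiv_context[of S m "p @ altw s t (Suc n)" "[]" "rev p" "[]"] by simp
  moreover have "rev p @ p @ altw s t (Suc n) \<approx> altw s t (Suc n)"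
    using cox_equiv_context[OF cox_equiv_rev[OF cox_matrix, of p], of "[]" "altw s t (Suc n)"] pl by simp
  ultimately have "altw s t (Suc n) \<approx> rev p" by (meson cox_equiv_sym cox_equiv_trans)
  then show False using r p(2) n by (auto simp: reduced_def dest!: spec[of _ "rev p"])
qed

text \<open>With \<open>w = v z\<close> for \<open>v\<close> of minimal length and \<open>z\<close> a word in \<open>s\<close> and the last letter \<open>t\<close> of \<open>w\<close>,
  the vector \<open>z (\<epsilon> s)\<close> is a nonnegative combination of \<open>\<epsilon> s\<close> and \<open>\<epsilon> t\<close>, both of which \<open>v\<close> sends
  into the cone by induction.\<close>

theorem reduced_snoc_pos:
  "reduced (w @ [s]) \<Longrightarrow> ac w (\<epsilon> s) \<in> pos_cone \<epsilon> S"
proof (induction "length w" arbitrary: w s rule: less_induct)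
  case less
  have s: "s \<in> S" using less.prems by (simp add: reduced_def)
  show ?case
  proof (cases w rule: rev_cases)
    case Nil
    then show ?thesis using pos_cone_generator[OF finite_S s] by simp
  next
    case (snoc w' t)
    have w: "reduced (w' @ [t])" using reduced_prefix less.prems snoc by blast
    have t: "t \<in> S" using w by (simp add: reduced_def)
    have st: "s \<noteq> t"
      using reduced_distinct_adj[of "[t, s]"] reduced_suffix[of w' "[t, s]"] less.prems snoc by auto
    obtain v z where vz: "w \<approx> v @ z" "z \<in> lists {s, t}" "length w = length v + length z"
      "length v \<le> length w'" "reduced (v @ z)" and v: "\<And>r. r \<in> {s, t} \<Longrightarrow> reduced (v @ [r])"
      using min_coset_decomposition[OF w, of "{s, t}"] s t snoc by auto
    have pos: "ac v (\<epsilon> s) \<in> pos_cone \<epsilon> S" "ac v (\<epsilon> t) \<in> pos_cone \<epsilon> S"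
      using less.hyps[of v] v vz(4) snoc by auto
    have "reduced ((v @ z) @ [s])"
      using reduced_cong[OF less.prems cox_equiv_append[OF vz(1) cox_equiv_refl]] vz(3) by simp
    then have zs: "reduced (z @ [s])" using reduced_suffix by simp
    have zset: "set z \<subseteq> {s, t}" using vz(2) by (auto simp: in_lists_conv_set)
    \<comment> \<open>Neighbours in a reduced word differ; over two letters this leaves only the
      alternating word ending in \<open>s\<close>.\<close>
    have "z @ [s] = altw t s (Suc (length z))"
      using altw_unique[of "z @ [s]" t s] reduced_distinct_adj[OF zs] st zset
      by (simp add: insert_commute)
    then have z: "z = altw s t (length z)" and red: "reduced (altw t s (Suc (length z)))"
      using altw_snoc[of t s "length z"] zs by (metis append1_eq_conv, metis)
    define U where "U = cheb (- B (\<epsilon> s) (\<epsilon> t))"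
    have mst: "m s t = m t s" using cox_matrix s t st by (auto simp: coxeter_matrix_def)
    \<comment> \<open>The final \<open>s\<close> counts as well, which gives exactly the bound
      needed for the larger of the two Chebyshev indices.\<close>
    have zn: "Suc (length z) \<le> n" if "m s t = enat n" for n
      using reduced_altw_length[OF t s st[symmetric] _ red] mst that by simp
    have U: "0 \<le> U (length z)" "0 \<le> U (Suc (length z))"
      unfolding U_def using zn by (auto intro!: root_cheb_nonneg s t st dest: Suc_leD)
    define p q where "p = (if even (length z) then U (Suc (length z)) else U (length z))"
      and "q = (if even (length z) then U (length z) else U (Suc (length z)))"
    have "ac z (\<epsilon> s) = p *\<^sub>R \<epsilon> s + q *\<^sub>R \<epsilon> t"
      using act_altw[of \<epsilon> s t "length z"] s t z by (simp add: p_def q_def U_def split: if_splits)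
    moreover have "v \<in> lists S" using vz(5) by (simp add: reduced_def)
    moreover have "ac w (\<epsilon> s) = ac v (ac z (\<epsilon> s))"
      using ceq_act[OF vz(1)] w snoc s by (simp add: reduced_def)
    ultimately have "ac w (\<epsilon> s) = p *\<^sub>R ac v (\<epsilon> s) + q *\<^sub>R ac v (\<epsilon> t)"
      using s t by (simp add: ac_add ac_scale)
    moreover have "0 \<le> p" "0 \<le> q" using U by (auto simp: p_def q_def)
    ultimately show ?thesis using pos by (simp add: pos_cone_add pos_cone_scale)
  qed
qed

section \<open>Positive and negative roots\<close>

lemma ac_root_nonzero:
  assumes "u \<in> lists S" "s \<in> S" shows "ac u (\<epsilon> s) \<noteq> 0"
  using ac_isometry[of u "\<epsilon> s" "\<epsilon> s"] B_zero[of 0] assms by auto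

lemma pos_cone_V: "x \<in> pos_cone \<epsilon> S \<Longrightarrow> x \<in> V"
  unfolding pos_cone_def by auto

lemma pos_cone_mono:
  assumes "X \<subseteq> S" "x \<in> pos_cone \<epsilon> X" shows "x \<in> pos_cone \<epsilon> S"
proof -
  have "finite X" using assms finite_S finite_subset by blast
  then show ?thesis using assms
    by (auto simp: pos_cone_def[of _ X] intro!: pos_cone_sum pos_cone_scale pos_cone_generator finite_S)
qed

text \<open>Here \<open>\<chi> x = 0\<close> is a sum of nonnegative terms in which each coefficient
  is multiplied by a positive number, so all coefficients vanish. This takes the place of linear
  independence.\<close>

lemma pos_cone_pointed:
  assumes "x \<in> pos_cone \<epsilon> S" "- x \<in> pos_cone \<epsilon> S" shows "x = 0"
proof -
  obtain \<chi> :: "'v \<Rightarrow> real" where lin: "linear_on V \<chi>" and pos: "\<And>s. s \<in> S \<Longrightarrow> 0 < \<chi> (\<epsilon> s)"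
    using root_basis unfolding root_basis_def by blast
  have sc: "\<chi> (c *\<^sub>R y) = c * \<chi> y" if "y \<in> V" for c y
    using lin that by (simp add: linear_on_def)
  have ad: "\<chi> (y + z) = \<chi> y + \<chi> z" if "y \<in> V" "z \<in> V" for y z
    using lin that by (simp add: linear_on_def)
  have \<chi>0: "\<chi> 0 = 0" using sc[of 0 0] by simp
  have \<chi>sum: "\<chi> (\<Sum>s\<in>X. c s *\<^sub>R \<epsilon> s) = (\<Sum>s\<in>X. c s * \<chi> (\<epsilon> s))" if "X \<subseteq> S" for X c
    using that by (induction X rule: infinite_finite_induct) (auto simp: \<chi>0 ad sc subset_iff)
  have nn: "0 \<le> \<chi> y" if "y \<in> pos_cone \<epsilon> S" for y
    using that \<chi>sum[OF subset_refl] pos by (force simp: pos_cone_def intro!: sum_nonneg)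
  have xV: "x \<in> V" using assms pos_cone_V by blast
  have "\<chi> (- x) = - \<chi> x" using sc[OF xV, of "-1"] by simp
  then have "\<chi> x = 0" using nn[OF assms(1)] nn[OF assms(2)] by simp
  moreover obtain c where c: "x = (\<Sum>s\<in>S. c s *\<^sub>R \<epsilon> s)" "\<forall>s\<in>S. 0 \<le> c s"
    using assms by (auto simp: pos_cone_def)
  ultimately have "(\<Sum>s\<in>S. c s * \<chi> (\<epsilon> s)) = 0" using \<chi>sum by simp
  then have "\<forall>s\<in>S. c s * \<chi> (\<epsilon> s) = 0"
    using sum_nonneg_eq_0_iff[OF finite_S, of "\<lambda>s. c s * \<chi> (\<epsilon> s)"] c pos by fastforce
  then have "\<forall>s\<in>S. c s = 0" using pos by fastforce
  then show ?thesis using c by simp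
qed

lemma ac_root_not_pos_neg:
  assumes "u \<in> lists S" "s \<in> S" "ac u (\<epsilon> s) \<in> pos_cone \<epsilon> S" "- ac u (\<epsilon> s) \<in> pos_cone \<epsilon> S"
  shows False
  using pos_cone_pointed[OF assms(3,4)] ac_root_nonzero assms by blast

text \<open>If \<open>w s\<close> is not reduced, \<open>w\<close> has a reduced form ending in
  \<open>s\<close>, whose last reflection negates \<open>\<epsilon> s\<close>.\<close>

lemma ac_root_sign:
  assumes u: "u \<in> lists S" and s: "s \<in> S"
  shows "ac u (\<epsilon> s) \<in> pos_cone \<epsilon> S \<or> - ac u (\<epsilon> s) \<in> pos_cone \<epsilon> S"
proof -
  obtain w where w: "u \<approx> w" "reduced w" using reduced_exists u by blast
  have uw: "ac u (\<epsilon> s) = ac w (\<epsilon> s)" using ceq_act w u s by simp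
  show ?thesis
  proof (cases "reduced (w @ [s])")
    case False
    then obtain v where v: "reduced (v @ [s])" "w \<approx> v @ [s]" using exchange_snoc w s by metis
    have "ac w (\<epsilon> s) = ac v (reflect B (\<epsilon> s) (\<epsilon> s))"
      using ceq_act[OF v(2)] w reduced_lists s by simp
    also have "reflect B (\<epsilon> s) (\<epsilon> s) = - \<epsilon> s" using s by (simp add: reflect_def scaleR_2)
    also have "ac v (- \<epsilon> s) = - ac v (\<epsilon> s)" using v s by (simp add: ac_minus reduced_def)
    finally show ?thesis using reduced_snoc_pos[OF v(1)] uw by simp
  qed (use reduced_snoc_pos uw in simp)
qed

text \<open>A nonempty reduced word makes the root of its last letter negative. This is the working
  form of faithfulness: triviality is decided by signs.\<close>

lemma ceq_Nil_if_pos: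
  assumes u: "u \<in> lists S" and pos: "\<And>s. s \<in> S \<Longrightarrow> ac u (\<epsilon> s) \<in> pos_cone \<epsilon> S"
  shows "u \<approx> []"
proof -
  obtain w where w: "u \<approx> w" "reduced w" using reduced_exists u by blast
  show ?thesis
  proof (cases w rule: rev_cases)
    case (snoc v s)
    have s: "s \<in> S" "v \<in> lists S" using w snoc by (auto simp: reduced_def)
    have "ac u (\<epsilon> s) = ac v (reflect B (\<epsilon> s) (\<epsilon> s))"
      using ceq_act[OF w(1)] u s snoc by simp
    also have "reflect B (\<epsilon> s) (\<epsilon> s) = - \<epsilon> s" using s by (simp add: reflect_def scaleR_2)
    also have "ac v (- \<epsilon> s) = - ac v (\<epsilon> s)" using s by (simp add: ac_minus)
    finally have "- ac u (\<epsilon> s) \<in> pos_cone \<epsilon> S" using reduced_snoc_pos[of v s] w snoc by simp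
    then show ?thesis using ac_root_not_pos_neg u s pos by blast
  qed (use w in simp)
qed

theorem ceq_iff_act:
  assumes u: "u \<in> lists S" and v: "v \<in> lists S"
  shows "u \<approx> v \<longleftrightarrow> (\<forall>x\<in>V. ac u x = ac v x)"
proof
  assume a: "\<forall>x\<in>V. ac u x = ac v x"
  have "rev v @ u \<approx> []"
    by (rule ceq_Nil_if_pos) (use u v a ac_rev pos_cone_generator[OF finite_S] in auto)
  then have "v @ rev v @ u \<approx> v" using cox_equiv_context[of S m "rev v @ u" "[]" v "[]"] by simp
  moreover have "v @ rev v @ u \<approx> u"
    using cox_equiv_context[OF cox_equiv_rev[OF cox_matrix, of "rev v"], of "[]" u] v by (simp add: in_lists_conv_set)
  ultimately show "u \<approx> v" by (meson cox_equiv_sym cox_equiv_trans)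
qed (use ceq_act u in blast)

end

section \<open>Orbits and longest elements\<close>

context root_system
begin

text \<open>\<open>V\<close> may stay while \<open>S\<close> shrinks because the roots need not span
  it. Instances at \<open>X\<close> give the sign dichotomy in the cone of \<open>X\<close>, which
  is sharper than that in the cone of \<open>S\<close>.\<close>

lemma root_system_subset:
  assumes X: "X \<subseteq> S" shows "root_system X m V B \<epsilon>"
proof
  show "finite X" using X finite_S by (rule finite_subset)
  show "coxeter_matrix X m" using cox_matrix X unfolding coxeter_matrix_def by blast
  show "root_basis X m V B \<epsilon>"
    using root_basis X unfolding root_basis_def by (blast intro: inj_on_subset)
qed

lemma cone_act:
  assumes "X \<subseteq> S" "u \<in> lists S" "\<And>t. t \<in> X \<Longrightarrow> ac u (\<epsilon> t) \<in> pos_cone \<epsilon> Y" "y \<in> pos_cone \<epsilon> X"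
  shows "ac u y \<in> pos_cone \<epsilon> Y"
proof -
  obtain c where c: "y = (\<Sum>s\<in>X. c s *\<^sub>R \<epsilon> s)" "\<forall>s\<in>X. 0 \<le> c s"
    using assms(4) by (auto simp: pos_cone_def)
  have "ac u y = (\<Sum>s\<in>X. c s *\<^sub>R ac u (\<epsilon> s))"
    using c assms(1,2) by (simp add: ac_sum ac_scale subset_iff)
  then show ?thesis using c assms(3) by (auto intro!: pos_cone_sum pos_cone_scale)
qed

text \<open>For \<open>X \<subseteq> S\<close> such a word represents the longest element of the parabolic subgroup \<open>W\<^sub>X\<close>;
  it exists iff \<open>W\<^sub>X\<close> is finite, but finiteness is never needed.\<close>

definition longest :: "'s set \<Rightarrow> 's list \<Rightarrow> bool" where
  "longest X z \<longleftrightarrow> z \<in> lists X \<and> (\<forall>t\<in>X. - ac z (\<epsilon> t) \<in> pos_cone \<epsilon> X)"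

lemma longest_cone:
  assumes X: "X \<subseteq> S" and z: "longest X z" and y: "y \<in> pos_cone \<epsilon> X"
  shows "- ac z y \<in> pos_cone \<epsilon> X"
proof -
  have zl: "z \<in> lists S" using z X by (auto simp: longest_def in_lists_conv_set)
  obtain c where c: "y = (\<Sum>s\<in>X. c s *\<^sub>R \<epsilon> s)" "\<forall>s\<in>X. 0 \<le> c s"
    using y by (auto simp: pos_cone_def)
  have "ac z y = (\<Sum>s\<in>X. c s *\<^sub>R ac z (\<epsilon> s))"
    using c X zl by (simp add: ac_sum ac_scale subset_iff)
  then have "- ac z y = (\<Sum>s\<in>X. c s *\<^sub>R (- ac z (\<epsilon> s)))" by (simp add: sum_negf)
  also have "\<dots> \<in> pos_cone \<epsilon> X"
    using c z by (intro pos_cone_sum pos_cone_scale) (auto simp: longest_def)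
  finally show ?thesis .
qed

text \<open>Two sign reversals leave all roots of \<open>X\<close> positive, so the product is
  trivial in the system of \<open>X\<close>. With \<open>z' = z\<close> this is the involution
  property, and both together give uniqueness.\<close>

lemma longest_prod:
  assumes X: "X \<subseteq> S" and z: "longest X z" "longest X z'" and x: "x \<in> V"
  shows "ac z' (ac z x) = x"
proof -
  interpret X: root_system X m V B \<epsilon> using X by (rule root_system_subset)
  have zl: "z \<in> lists X" "z' \<in> lists X" "z \<in> lists S" "z' \<in> lists S"
    using z X by (auto simp: longest_def in_lists_conv_set)
  have "ac (z' @ z) (\<epsilon> t) \<in> pos_cone \<epsilon> X" if t: "t \<in> X" for t
  proof -
    have "- ac z' (- ac z (\<epsilon> t)) \<in> pos_cone \<epsilon> X"
      by (rule longest_cone[OF X z(2)]) (use z t in \<open>auto simp: longest_def\<close>)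
    then show ?thesis using t X zl by (simp add: ac_minus subset_iff)
  qed
  then have "cox_equiv X m (z' @ z) []" using zl by (intro X.ceq_Nil_if_pos) auto
  from X.ceq_act[OF this _ x] show ?thesis using zl by simp
qed

lemma longest_involution: "X \<subseteq> S \<Longrightarrow> longest X z \<Longrightarrow> x \<in> V \<Longrightarrow> ac z (ac z x) = x"
  by (rule longest_prod)

lemma longest_unique:
  assumes X: "X \<subseteq> S" and z: "longest X z" "longest X z'" and x: "x \<in> V"
  shows "ac z' x = ac z x"
proof -
  have zl: "z \<in> lists S" using z X by (auto simp: longest_def in_lists_conv_set)
  show ?thesis using longest_prod[OF X z, of "ac z x"] longest_involution[OF X z(1)] zl x by simp
qed

text \<open>Each letter adds a multiple of its own root. For \<open>x\<close> in
  \<open>V\<^sup>G\<close> and an orbit \<open>X\<close>, averaging will turn the combination into a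
  multiple of one orbit sum.\<close>

lemma act_diff_span:
  assumes "X \<subseteq> S" "z \<in> lists X" "x \<in> V"
  shows "\<exists>c. ac z x - x = (\<Sum>t\<in>X. c t *\<^sub>R \<epsilon> t)"
  using assms(2)
proof (induction z)
  case Nil
  then show ?case by (intro exI[of _ "\<lambda>_. 0"]) simp
next
  case (Cons s z)
  then obtain c where c: "ac z x - x = (\<Sum>t\<in>X. c t *\<^sub>R \<epsilon> t)" by auto
  define r where "r = - 2 * B (ac z x) (\<epsilon> s)"
  have fX: "finite X" using assms(1) finite_S finite_subset by blast
  have "(\<Sum>t\<in>X. (c t + (if t = s then r else 0)) *\<^sub>R \<epsilon> t)
      = (\<Sum>t\<in>X. c t *\<^sub>R \<epsilon> t) + (\<Sum>t\<in>X. if t = s then r *\<^sub>R \<epsilon> t else 0)"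
    by (simp add: scaleR_add_left sum.distrib if_distrib[of "\<lambda>c. c *\<^sub>R _"] cong: if_cong)
  also have "\<dots> = (ac z x - x) + r *\<^sub>R \<epsilon> s" using Cons fX c by (simp add: sum.delta)
  also have "\<dots> = ac (s # z) x - x" by (simp add: reflect_def r_def)
  finally show ?case by metis
qed

text \<open>The last letter acts first and adds a nonnegative multiple of
  \<open>\<epsilon> t\<close>, which the prefix sends into the cone. The use is the positive norm of
  orbit sums.\<close>

lemma reduced_antidominant:
  assumes y: "y \<in> V" "\<And>t. t \<in> S \<Longrightarrow> B y (\<epsilon> t) \<le> 0"
  shows "reduced u \<Longrightarrow> ac u y - y \<in> pos_cone \<epsilon> S"
proof (induction u rule: rev_induct)
  case (snoc t u)
  have t: "t \<in> S" "u \<in> lists S" using snoc by (auto simp: reduced_def)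
  have "ac (u @ [t]) y = ac u (y + (- 2 * B y (\<epsilon> t)) *\<^sub>R \<epsilon> t)" by (simp add: reflect_def)
  also have "\<dots> = ac u y + (- 2 * B y (\<epsilon> t)) *\<^sub>R ac u (\<epsilon> t)"
    using t y(1) by (simp only: ac_add ac_scale V_closed root_in_V)
  finally have "ac (u @ [t]) y - y = (ac u y - y) + (- 2 * B y (\<epsilon> t)) *\<^sub>R ac u (\<epsilon> t)" by simp
  moreover have "ac u y - y \<in> pos_cone \<epsilon> S" using snoc reduced_prefix by blast
  moreover have "0 \<le> - 2 * B y (\<epsilon> t)" using y(2)[OF t(1)] by simp
  ultimately show ?case
    using reduced_snoc_pos[OF snoc.prems] by (metis pos_cone_add pos_cone_scale)
qed (simp add: pos_cone_zero)

lemma antidominant: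
  assumes y: "y \<in> V" "\<And>t. t \<in> S \<Longrightarrow> B y (\<epsilon> t) \<le> 0" and u: "u \<in> lists S"
  shows "ac u y - y \<in> pos_cone \<epsilon> S"
proof -
  obtain w where "u \<approx> w" "reduced w" using reduced_exists u by blast
  then show ?thesis using reduced_antidominant[OF y] ceq_act[of u w y] u y by simp
qed

end

section \<open>Symmetries and fixed vectors\<close>

locale sym_root_system = root_system S m V B \<epsilon>
  for S :: "'s set" and m and V :: "'v::real_vector set" and B and \<epsilon> +
  fixes G :: "('s \<Rightarrow> 's) set" and \<rho> :: "('s \<Rightarrow> 's) \<Rightarrow> 'v \<Rightarrow> 'v"
  assumes sym_G: "symmetry_group S m G" and emb: "embeds_compatibly G S V B \<epsilon> \<rho>"
begin

lemma G_subgroup: "subgroup G (BijGroup S)"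
  using sym_G by (simp add: symmetry_group_def)

lemma G_Bij: "g \<in> G \<Longrightarrow> g \<in> Bij S"
  using subgroup.subset[OF G_subgroup] by (auto simp: BijGroup_def)

lemma G_bij: "g \<in> G \<Longrightarrow> bij_betw g S S"
  and G_ext: "g \<in> G \<Longrightarrow> g \<in> extensional S"
  using G_Bij by (auto simp: Bij_def)

lemma G_S [simp]: "g \<in> G \<Longrightarrow> s \<in> S \<Longrightarrow> g s \<in> S"
  using G_bij by (auto simp: bij_betw_def)

lemma G_finite: "finite G"
proof (rule finite_subset)
  show "G \<subseteq> S \<rightarrow>\<^sub>E S" using G_ext by (auto simp: PiE_def)
  show "finite (S \<rightarrow>\<^sub>E S)" using finite_S by (intro finite_PiE) auto
qed

lemma G_compose: "g \<in> G \<Longrightarrow> h \<in> G \<Longrightarrow> compose S g h \<in> G"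
  using subgroup.m_closed[OF G_subgroup, of g h] G_Bij by (simp add: BijGroup_def)

lemma G_id: "\<exists>e\<in>G. \<forall>s\<in>S. e s = s"
proof (rule bexI)
  show "(\<lambda>x\<in>S. x) \<in> G" using subgroup.one_closed[OF G_subgroup] by (simp add: BijGroup_def)
qed simp

lemma G_nonempty: "G \<noteq> {}"
  using G_id by auto

lemma G_inverse:
  assumes g: "g \<in> G" obtains h where "h \<in> G" "\<And>s. s \<in> S \<Longrightarrow> h (g s) = s" "\<And>s. s \<in> S \<Longrightarrow> g (h s) = s"
proof -
  let ?h = "inv\<^bsub>BijGroup S\<^esub> g"
  have h: "?h \<in> G" using subgroup.m_inv_closed[OF G_subgroup g] .
  have "?h = (\<lambda>x\<in>S. (inv_into S g) x)" using G_Bij[OF g] by (rule inv_BijGroup)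
  then show ?thesis using that[OF h] G_bij[OF g] g
    by (simp add: bij_betw_def inv_into_f_f f_inv_into_f)
qed

text \<open>Translation by \<open>h\<close> permutes \<open>G\<close>. Composition is restricted to
  \<open>S\<close> since the elements of \<open>G\<close> are extensional functions.\<close>

lemma sum_G_right:
  assumes h: "h \<in> G" and s: "s \<in> S"
  shows "(\<Sum>g\<in>G. F (g (h s))) = (\<Sum>g\<in>G. F (g s))"
proof -
  obtain k where k: "k \<in> G" "\<And>s. s \<in> S \<Longrightarrow> k (h s) = s" "\<And>s. s \<in> S \<Longrightarrow> h (k s) = s"
    using G_inverse[OF h] by blast
  show ?thesis
    by (rule sum.reindex_bij_witness[where i = "\<lambda>g. compose S g k" and j = "\<lambda>g. compose S g h"])
      (auto simp: G_compose h k s compose_eq intro!: extensionalityI[where A = S] G_ext)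
qed

lemma sum_G_left:
  assumes h: "h \<in> G" and s: "s \<in> S"
  shows "(\<Sum>g\<in>G. F (h (g s))) = (\<Sum>g\<in>G. F (g s))"
proof -
  obtain k where k: "k \<in> G" "\<And>s. s \<in> S \<Longrightarrow> k (h s) = s" "\<And>s. s \<in> S \<Longrightarrow> h (k s) = s"
    using G_inverse[OF h] by blast
  show ?thesis
    by (rule sum.reindex_bij_witness[where i = "\<lambda>g. compose S k g" and j = "\<lambda>g. compose S h g"])
      (auto simp: G_compose h k s compose_eq intro!: extensionalityI[where A = S] G_ext)
qed

lemma rho_GL: "g \<in> G \<Longrightarrow> \<rho> g \<in> Bij V \<and> linear_on V (\<rho> g)"
  using emb by (auto simp: embeds_compatibly_def hom_def GL_def)

lemma rho_V [simp]: "g \<in> G \<Longrightarrow> x \<in> V \<Longrightarrow> \<rho> g x \<in> V"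
  using rho_GL by (auto simp: Bij_def bij_betw_def)

lemma rho_surj: "g \<in> G \<Longrightarrow> x \<in> V \<Longrightarrow> \<exists>y\<in>V. x = \<rho> g y"
  using rho_GL by (auto simp: Bij_def bij_betw_def)

lemma rho_root [simp]: "g \<in> G \<Longrightarrow> s \<in> S \<Longrightarrow> \<rho> g (\<epsilon> s) = \<epsilon> (g s)"
  and rho_form: "g \<in> G \<Longrightarrow> x \<in> V \<Longrightarrow> y \<in> V \<Longrightarrow> B (\<rho> g x) (\<rho> g y) = B x y"
  using emb by (auto simp: embeds_compatibly_def)

lemma rho_add: "g \<in> G \<Longrightarrow> x \<in> V \<Longrightarrow> y \<in> V \<Longrightarrow> \<rho> g (x + y) = \<rho> g x + \<rho> g y"
  and rho_scale: "g \<in> G \<Longrightarrow> x \<in> V \<Longrightarrow> \<rho> g (c *\<^sub>R x) = c *\<^sub>R \<rho> g x"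
  using rho_GL by (auto simp: linear_on_def)

lemma rho_minus: "g \<in> G \<Longrightarrow> x \<in> V \<Longrightarrow> \<rho> g (- x) = - \<rho> g x"
  using rho_scale[of g x "-1"] by simp

lemma rho_diff: "g \<in> G \<Longrightarrow> x \<in> V \<Longrightarrow> y \<in> V \<Longrightarrow> \<rho> g (x - y) = \<rho> g x - \<rho> g y"
  using rho_add[of g x "-y"] rho_minus[of g y] by simp

lemma rho_sum: "g \<in> G \<Longrightarrow> (\<And>i. i \<in> I \<Longrightarrow> x i \<in> V) \<Longrightarrow> \<rho> g (sum x I) = (\<Sum>i\<in>I. \<rho> g (x i))"
  using rho_scale[of g 0 0] by (induction I rule: infinite_finite_induct) (auto simp: rho_add)

abbreviation VG where "VG \<equiv> fixed_vectors V G \<rho>"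

lemma VG_V [simp]: "x \<in> VG \<Longrightarrow> x \<in> V"
  and VG_fixed: "x \<in> VG \<Longrightarrow> g \<in> G \<Longrightarrow> \<rho> g x = x"
  by (auto simp: fixed_vectors_def)

lemma VG_I: "x \<in> V \<Longrightarrow> (\<And>g. g \<in> G \<Longrightarrow> \<rho> g x = x) \<Longrightarrow> x \<in> VG"
  by (simp add: fixed_vectors_def del: VG_V)

lemma subspace_VG: "subspace VG"
  unfolding subspace_def
proof (intro conjI ballI allI)
  show "0 \<in> VG" using rho_scale[of _ 0 0] by (auto intro!: VG_I)
  show "x + y \<in> VG" if "x \<in> VG" "y \<in> VG" for x y
    using that by (intro VG_I) (simp_all add: rho_add VG_fixed)
  show "c *\<^sub>R x \<in> VG" if "x \<in> VG" for c x
    using that by (intro VG_I) (simp_all add: rho_scale VG_fixed)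
qed

lemma form_space_VG: "form_space VG B"
proof
  show "symmetric_bilinear_on VG B"
    unfolding symmetric_bilinear_on_def linear_on_def
    by (intro conjI ballI allI)
      (simp_all add: B_add_right B_scale_right B_add_left B_scale_left, rule B_sym, simp_all)
qed (rule subspace_VG)

section \<open>Orbits and orbit sums\<close>

definition orb :: "'s \<Rightarrow> 's set" where "orb s = (\<lambda>g. g s) ` G"

text \<open>Summing over \<open>G\<close> counts each root once per element of a stabiliser, but
  makes invariance a mere translation of \<open>G\<close>. The multiplicity disappears in
  \<open>orbit_root\<close>.\<close>

definition orbit_sum :: "'s \<Rightarrow> 'v" where "orbit_sum s = (\<Sum>g\<in>G. \<epsilon> (g s))"

lemma orb_S: "s \<in> S \<Longrightarrow> orb s \<subseteq> S"
  by (auto simp: orb_def)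

lemma orb_self: "s \<in> S \<Longrightarrow> s \<in> orb s"
proof -
  assume s: "s \<in> S"
  obtain e where e: "e \<in> G" "\<forall>s\<in>S. e s = s" using G_id by blast
  have "(\<lambda>g. g s) e \<in> orb s" unfolding orb_def by (rule imageI[OF e(1)])
  then show "s \<in> orb s" using e s by simp
qed

lemma orb_closed:
  assumes "s \<in> S" "t \<in> orb s" "g \<in> G" shows "g t \<in> orb s"
proof -
  obtain h where h: "h \<in> G" "t = h s" using assms by (auto simp: orb_def)
  then have "g t = compose S g h s" using assms by (simp add: compose_eq)
  then show ?thesis using G_compose[OF assms(3) h(1)] by (auto simp: orb_def)
qed

lemma orb_eq:
  assumes s: "s \<in> S" and t: "t \<in> orb s" shows "orb t = orb s"
proof -
  obtain g where g: "g \<in> G" "t = g s" using t by (auto simp: orb_def)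
  obtain h where h: "h \<in> G" "h t = s" using G_inverse[OF g(1)] g s by metis
  have tS: "t \<in> S" using t s orb_S by blast
  have "orb b \<subseteq> orb a" if "a \<in> S" "b \<in> orb a" for a b
    using orb_closed[OF that] by (auto simp: orb_def[of b])
  moreover have "s \<in> orb t" using h by (auto simp: orb_def)
  ultimately show ?thesis using s t tS by blast
qed

lemma orb_disjoint: "s \<in> S \<Longrightarrow> t \<in> S \<Longrightarrow> orb s \<noteq> orb t \<Longrightarrow> orb s \<inter> orb t = {}"
  using orb_eq by blast

lemma orbit_sum_orb: "s \<in> S \<Longrightarrow> t \<in> orb s \<Longrightarrow> orbit_sum t = orbit_sum s"
  using sum_G_right by (auto simp: orb_def orbit_sum_def)

lemma orbit_sum_V [simp]: "s \<in> S \<Longrightarrow> orbit_sum s \<in> V"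
  by (simp add: orbit_sum_def)

lemma orbit_sum_VG [simp]: "s \<in> S \<Longrightarrow> orbit_sum s \<in> VG"
  using sum_G_left[of _ s \<epsilon>] by (intro VG_I) (simp_all add: orbit_sum_def rho_sum)

lemma orbit_sum_cone:
  assumes "s \<in> S" shows "orbit_sum s \<in> pos_cone \<epsilon> (orb s)"
  unfolding orbit_sum_def
proof (rule pos_cone_sum)
  fix g assume "g \<in> G"
  then have "g s \<in> orb s" by (simp add: orb_def)
  then show "\<epsilon> (g s) \<in> pos_cone \<epsilon> (orb s)"
    using finite_subset[OF orb_S[OF assms] finite_S] by (intro pos_cone_generator)
qed

text \<open>If the sum vanished, the remaining terms would put \<open>- \<epsilon> s\<close> into
  the pointed cone.\<close>

lemma orbit_sum_nonzero:
  assumes s: "s \<in> S" shows "orbit_sum s \<noteq> 0"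
proof
  assume 0: "orbit_sum s = 0"
  obtain e where e: "e \<in> G" "e s = s" using G_id s by auto
  have "orbit_sum s = \<epsilon> s + (\<Sum>g\<in>G - {e}. \<epsilon> (g s))"
    using sum.remove[OF G_finite e(1), of "\<lambda>g. \<epsilon> (g s)"] e(2) by (simp add: orbit_sum_def)
  then have "- \<epsilon> s = (\<Sum>g\<in>G - {e}. \<epsilon> (g s))" using 0 by (simp add: add_eq_0_iff)
  also have "\<dots> \<in> pos_cone \<epsilon> S" using s finite_S by (intro pos_cone_sum pos_cone_generator) auto
  finally show False
    using pos_cone_pointed[of "\<epsilon> s"] ac_root_nonzero[of "[]" s] pos_cone_generator[OF finite_S s, of \<epsilon>] s
    by simp
qed

text \<open>The \<open>\<epsilon> t\<close> may be linearly dependent, so that a fixed combination need not have constant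
  coefficients on orbits; averaging over \<open>G\<close> replaces this.\<close>

lemma average:
  assumes X: "X \<subseteq> S" and v: "(\<Sum>t\<in>X. c t *\<^sub>R \<epsilon> t) \<in> VG"
  shows "real (card G) *\<^sub>R (\<Sum>t\<in>X. c t *\<^sub>R \<epsilon> t) = (\<Sum>t\<in>X. c t *\<^sub>R orbit_sum t)"
proof -
  let ?v = "\<Sum>t\<in>X. c t *\<^sub>R \<epsilon> t"
  have "real (card G) *\<^sub>R ?v = (\<Sum>g\<in>G. ?v)" by (simp add: sum_constant_scaleR)
  also have "\<dots> = (\<Sum>g\<in>G. \<rho> g ?v)" using v VG_fixed by (intro sum.cong) auto
  also have "\<dots> = (\<Sum>g\<in>G. \<Sum>t\<in>X. c t *\<^sub>R \<epsilon> (g t))"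
    using X by (intro sum.cong) (simp_all add: rho_sum rho_scale subset_iff)
  also have "\<dots> = (\<Sum>t\<in>X. \<Sum>g\<in>G. c t *\<^sub>R \<epsilon> (g t))" by (rule sum.swap)
  finally show ?thesis by (simp add: orbit_sum_def scaleR_right.sum)
qed

lemma card_G: "0 < real (card G)"
  using G_finite G_nonempty by (simp add: card_gt_0_iff)

text \<open>The vertices of one orbit share their orbit sum, so averaging leaves a single
  vector.\<close>

lemma average_orb:
  assumes s: "s \<in> S" and v: "(\<Sum>t\<in>orb s. c t *\<^sub>R \<epsilon> t) \<in> VG"
  shows "(\<Sum>t\<in>orb s. c t *\<^sub>R \<epsilon> t) = (sum c (orb s) / real (card G)) *\<^sub>R orbit_sum s"
proof -
  have "real (card G) *\<^sub>R (\<Sum>t\<in>orb s. c t *\<^sub>R \<epsilon> t) = sum c (orb s) *\<^sub>R orbit_sum s"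
    unfolding average[OF orb_S[OF s] v] scaleR_left.sum
    by (intro sum.cong) (simp_all add: orbit_sum_orb[OF s])
  then have "(1 / real (card G)) *\<^sub>R (real (card G) *\<^sub>R (\<Sum>t\<in>orb s. c t *\<^sub>R \<epsilon> t))
      = (1 / real (card G)) *\<^sub>R (sum c (orb s) *\<^sub>R orbit_sum s)" by simp
  then show ?thesis using card_G by simp
qed

lemma rho_cone:
  assumes X: "X \<subseteq> S" "\<And>t. t \<in> X \<Longrightarrow> g t \<in> X" and g: "g \<in> G" and y: "y \<in> pos_cone \<epsilon> X"
  shows "\<rho> g y \<in> pos_cone \<epsilon> X"
proof -
  obtain c where c: "y = (\<Sum>s\<in>X. c s *\<^sub>R \<epsilon> s)" "\<forall>s\<in>X. 0 \<le> c s"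
    using y by (auto simp: pos_cone_def)
  have "\<rho> g y = (\<Sum>s\<in>X. c s *\<^sub>R \<epsilon> (g s))"
    using c g X by (simp add: rho_sum rho_scale subset_iff)
  then show ?thesis using c X finite_subset[OF X(1) finite_S]
    by (auto intro!: pos_cone_sum pos_cone_scale pos_cone_generator)
qed

section \<open>Equivariant words\<close>

lemma act_map:
  "g \<in> G \<Longrightarrow> u \<in> lists S \<Longrightarrow> x \<in> V \<Longrightarrow> ac (map g u) (\<rho> g x) = \<rho> g (ac u x)"
proof (induction u)
  case (Cons s u)
  then have s: "s \<in> S" "u \<in> lists S" by auto
  have "B (\<rho> g (ac u x)) (\<epsilon> (g s)) = B (ac u x) (\<epsilon> s)"
    using rho_form[of g "ac u x" "\<epsilon> s"] Cons.prems s by simp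
  then show ?case using Cons s by (simp add: reflect_def rho_diff rho_scale)
qed simp

text \<open>Invariance is asked of the action and not of the word; this is how membership of the
  represented element in \<open>W\<^sup>G\<close> is seen on \<open>V\<close>.\<close>

definition equivariant :: "'s list \<Rightarrow> bool" where
  "equivariant u \<longleftrightarrow> u \<in> lists S \<and> (\<forall>g\<in>G. \<forall>x\<in>V. ac u (\<rho> g x) = \<rho> g (ac u x))"

lemma equivariant_lists [simp]: "equivariant u \<Longrightarrow> u \<in> lists S"
  by (simp add: equivariant_def)

lemma equivariant_iff:
  assumes "u \<in> lists S"
  shows "equivariant u \<longleftrightarrow> (\<forall>g\<in>G. \<forall>x\<in>V. ac (map g u) x = ac u x)"
  unfolding equivariant_def using act_map rho_surj rho_V assms by metis

lemma equivariant_VG [simp]: "equivariant u \<Longrightarrow> x \<in> VG \<Longrightarrow> ac u x \<in> VG"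
  by (rule VG_I, simp, metis VG_V VG_fixed equivariant_def)

lemma equivariant_Nil: "equivariant []"
  by (simp add: equivariant_def)

lemma equivariant_append: "equivariant u \<Longrightarrow> equivariant v \<Longrightarrow> equivariant (u @ v)"
  by (simp add: equivariant_def)

lemma equivariant_rev:
  assumes u: "equivariant u" shows "equivariant (rev u)"
proof -
  have ul: "u \<in> lists S" "rev u \<in> lists S" using u by (auto simp: in_lists_conv_set equivariant_def)
  have "ac (rev u) (\<rho> g x) = \<rho> g (ac (rev u) x)" if "g \<in> G" "x \<in> V" for g x
  proof -
    have "x = ac u (ac (rev u) x)" using ac_rev[OF ul(2) that(2)] by simp
    then have "ac (rev u) (\<rho> g x) = ac (rev u) (\<rho> g (ac u (ac (rev u) x)))" by simp
    also have "\<dots> = ac (rev u) (ac u (\<rho> g (ac (rev u) x)))" using u that ul by (simp add: equivariant_def)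
    finally show ?thesis using ac_rev ul that by simp
  qed
  then show ?thesis using ul by (simp add: equivariant_def)
qed

text \<open>\<open>g\<close> permutes the orbit, so \<open>map g z\<close> reverses its signs too,
  and longest words of the same orbit act alike.\<close>

lemma longest_equivariant:
  assumes s: "s \<in> S" and z: "longest (orb s) z" shows "equivariant z"
proof -
  have zl: "z \<in> lists (orb s)" "z \<in> lists S"
    using z orb_S[OF s] by (auto simp: longest_def in_lists_conv_set)
  have "longest (orb s) (map g z)" if g: "g \<in> G" for g
    unfolding longest_def
  proof (intro conjI ballI)
    show "map g z \<in> lists (orb s)" using zl orb_closed[OF s _ g] by (auto simp: in_lists_conv_set)
    fix t assume t: "t \<in> orb s"
    obtain h where h: "h \<in> G" "\<And>s. s \<in> S \<Longrightarrow> g (h s) = s" using G_inverse[OF g] by metis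
    have ht: "h t \<in> orb s" "g (h t) = t" "h t \<in> S" using orb_closed orb_S s t h by blast+
    have "ac (map g z) (\<epsilon> t) = \<rho> g (ac z (\<epsilon> (h t)))"
      using act_map[OF g zl(2), of "\<epsilon> (h t)"] ht g by simp
    then have "- ac (map g z) (\<epsilon> t) = \<rho> g (- ac z (\<epsilon> (h t)))" using g zl ht by (simp add: rho_minus)
    also have "\<dots> \<in> pos_cone \<epsilon> (orb s)"
      using z ht g s orb_closed by (intro rho_cone orb_S) (auto simp: longest_def)
    finally show "- ac (map g z) (\<epsilon> t) \<in> pos_cone \<epsilon> (orb s)" .
  qed
  then show ?thesis using longest_unique[OF orb_S[OF s] z] equivariant_iff[OF zl(2)] by simp
qed

text \<open>For \<open>x\<close> in \<open>V\<^sup>G\<close> the vector \<open>z x - x\<close> is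
  fixed and lies in the span of the orbit, hence is a multiple of the orbit sum \<open>a\<close>. So
  \<open>z a = q a\<close>; the involution gives \<open>q = 1\<close> or \<open>q = -1\<close>, and
  the sign reversal excludes \<open>1\<close>.\<close>

lemma longest_orbit_sum:
  assumes s: "s \<in> S" and z: "longest (orb s) z"
  shows "ac z (orbit_sum s) = - orbit_sum s"
    and "0 < B (orbit_sum s) (orbit_sum s)"
    and "x \<in> VG \<Longrightarrow> \<exists>r. ac z x = x + r *\<^sub>R orbit_sum s"
proof -
  let ?a = "orbit_sum s"
  have zl: "z \<in> lists (orb s)" "z \<in> lists S"
    using z orb_S[OF s] by (auto simp: longest_def in_lists_conv_set)
  have ez: "equivariant z" using longest_equivariant s z .
  show diff: "\<exists>r. ac z x = x + r *\<^sub>R ?a" if x: "x \<in> VG" for x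
  proof -
    obtain c where c: "ac z x - x = (\<Sum>t\<in>orb s. c t *\<^sub>R \<epsilon> t)"
      using act_diff_span[OF orb_S[OF s] zl(1), of x] x by auto
    have "ac z x - x \<in> VG" using x ez subspace_VG by (simp add: subspace_diff)
    then have "ac z x - x = (sum c (orb s) / real (card G)) *\<^sub>R ?a"
      using average_orb[OF s, of c] c by simp
    then show ?thesis by (metis add.commute diff_add_cancel)
  qed
  obtain r where r: "ac z ?a = ?a + r *\<^sub>R ?a" using diff[of ?a] s by auto
  define q where "q = 1 + r"
  have q: "ac z ?a = q *\<^sub>R ?a" using r by (simp add: q_def scaleR_add_left)
  have "?a = ac z (ac z ?a)" using longest_involution[OF orb_S[OF s] z] s by simp
  also have "\<dots> = (q * q) *\<^sub>R ?a" using q zl s by (simp add: ac_scale)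
  finally have "(q * q - 1) *\<^sub>R ?a = 0" by (simp add: scaleR_diff_left)
  then have "q * q = 1" using orbit_sum_nonzero[OF s] by simp
  then have q1: "q = 1 \<or> q = -1" by (simp add: square_eq_1_iff)
  have cone: "?a \<in> pos_cone \<epsilon> S" using pos_cone_mono orb_S orbit_sum_cone s by blast
  have "- ac z ?a \<in> pos_cone \<epsilon> (orb s)" using longest_cone orb_S orbit_sum_cone s z by blast
  then have "- ac z ?a \<in> pos_cone \<epsilon> S" using pos_cone_mono orb_S s by blast
  then have "q \<noteq> 1" using q pos_cone_pointed[OF cone] orbit_sum_nonzero[OF s] by auto
  then show neg: "ac z ?a = - ?a" using q q1 by simp
  have inv: "B ?a (\<epsilon> (g s)) = B ?a (\<epsilon> s)" if "g \<in> G" for g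
    using rho_form[OF that, of ?a "\<epsilon> s"] VG_fixed[of ?a g] that s by simp
  have "B ?a ?a = (\<Sum>g\<in>G. B ?a (\<epsilon> (g s)))"
    using s by (subst (2) orbit_sum_def) (simp add: B_sum_right)
  then have card: "B ?a ?a = real (card G) * B ?a (\<epsilon> s)" by (simp add: inv)
  \<comment> \<open>All \<open>B a (\<epsilon> t)\<close> agree on the orbit, so a nonpositive norm
    would make \<open>a\<close> antidominant there, and \<open>z a - a = - 2 a\<close> would lie in
    the cone.\<close>
  show "0 < B ?a ?a"
  proof (rule ccontr)
    assume "\<not> 0 < B ?a ?a"
    then have "B ?a (\<epsilon> s) \<le> 0" using card card_G by (metis not_le mult_pos_pos)
    then have le: "B ?a (\<epsilon> t) \<le> 0" if "t \<in> orb s" for t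
      using that by (auto simp: orb_def inv)
    interpret X: root_system "orb s" m V B \<epsilon> using root_system_subset orb_S s by blast
    have "ac z ?a - ?a \<in> pos_cone \<epsilon> (orb s)"
      using X.antidominant[of ?a z] zl s le by simp
    then have "(1/2) *\<^sub>R (ac z ?a - ?a) \<in> pos_cone \<epsilon> S"
      by (intro pos_cone_scale pos_cone_mono[OF orb_S[OF s]]) auto
    moreover have "(1/2) *\<^sub>R (ac z ?a - ?a) = - ?a"
      using scaleR_half_double[of "- ?a"] by (simp add: neg)
    ultimately show False using pos_cone_pointed[OF cone] orbit_sum_nonzero[OF s] by simp
  qed
qed

lemma equivariant_act: "equivariant u \<Longrightarrow> g \<in> G \<Longrightarrow> x \<in> V \<Longrightarrow> ac u (\<rho> g x) = \<rho> g (ac u x)"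
  unfolding equivariant_def by blast

lemma equivariant_root:
  "equivariant u \<Longrightarrow> g \<in> G \<Longrightarrow> s \<in> S \<Longrightarrow> ac u (\<epsilon> (g s)) = \<rho> g (ac u (\<epsilon> s))"
  using equivariant_act[of u g "\<epsilon> s"] by simp

section \<open>Normalised orbit sums and their reflections\<close>

definition orbit_root :: "'s \<Rightarrow> 'v" where
  "orbit_root s = (1 / sqrt (B (orbit_sum s) (orbit_sum s))) *\<^sub>R orbit_sum s"

definition spherical :: "'s set" where
  "spherical = {s \<in> S. \<exists>z. longest (orb s) z}"

text \<open>The choice depends on \<open>orb s\<close> alone, so vertices of one orbit get the same
  word and not just equivalent ones.\<close>

definition longest_word :: "'s \<Rightarrow> 's list" where
  "longest_word s = (SOME z. longest (orb s) z)"

lemma spherical_S [simp]: "s \<in> spherical \<Longrightarrow> s \<in> S"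
  by (simp add: spherical_def)

lemma longest_word: "s \<in> spherical \<Longrightarrow> longest (orb s) (longest_word s)"
  unfolding spherical_def longest_word_def by (auto intro: someI_ex)

lemma longest_word_equivariant: "s \<in> spherical \<Longrightarrow> equivariant (longest_word s)"
  by (rule longest_equivariant[of s]) (simp_all add: longest_word)

lemma longest_word_lists: "s \<in> spherical \<Longrightarrow> longest_word s \<in> lists (orb s)"
  using longest_word by (simp add: longest_def)

lemma orbit_root_scale:
  assumes "s \<in> spherical"
  obtains k where "0 < k" "orbit_root s = k *\<^sub>R orbit_sum s" "orbit_sum s = (1 / k) *\<^sub>R orbit_root s"
    "k * k * B (orbit_sum s) (orbit_sum s) = 1"
proof -
  let ?n = "B (orbit_sum s) (orbit_sum s)"
  have n: "0 < ?n" using longest_orbit_sum(2)[OF _ longest_word[OF assms]] assms by simp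
  define k where "k = 1 / sqrt ?n"
  have k: "0 < k" using n by (simp add: k_def)
  have "orbit_root s = k *\<^sub>R orbit_sum s" by (simp add: orbit_root_def k_def)
  moreover from this have "orbit_sum s = (1 / k) *\<^sub>R orbit_root s" using k by simp
  moreover have "k * k * ?n = 1" using n by (simp add: k_def)
  ultimately show ?thesis using that[of k] k by blast
qed

lemma orbit_root_VG [simp]: "s \<in> spherical \<Longrightarrow> orbit_root s \<in> VG"
  using subspace_scale[OF subspace_VG] by (simp add: orbit_root_def)

lemma orbit_root_unit:
  assumes s: "s \<in> spherical" shows "B (orbit_root s) (orbit_root s) = 1"
proof -
  obtain k where k: "orbit_root s = k *\<^sub>R orbit_sum s" "k * k * B (orbit_sum s) (orbit_sum s) = 1"
    using orbit_root_scale[OF s] by metis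
  show ?thesis unfolding k(1) using k(2) s by (simp add: B_simps)
qed

text \<open>From \<open>z x = x + r a\<close> and \<open>z a = - a\<close>, comparing
  \<open>B (z x) (z a)\<close> with \<open>B x a\<close> determines \<open>r\<close>.\<close>

lemma longest_word_act:
  assumes s: "s \<in> spherical" and x: "x \<in> VG"
  shows "ac (longest_word s) x = reflect B (orbit_root s) x"
proof -
  let ?z = "longest_word s" and ?a = "orbit_sum s"
  have z: "longest (orb s) ?z" "s \<in> S" "?z \<in> lists S"
    using s longest_word longest_word_equivariant by auto
  obtain k where k: "0 < k" "orbit_root s = k *\<^sub>R ?a" "k * k * B ?a ?a = 1"
    using orbit_root_scale s by metis
  obtain r where r: "ac ?z x = x + r *\<^sub>R ?a" using longest_orbit_sum(3) z x by blast
  have "B (ac ?z x) (ac ?z ?a) = B x ?a" using z x by (simp add: ac_isometry)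
  then have "- B x ?a - r * B ?a ?a = B x ?a"
    using longest_orbit_sum(1)[OF z(2,1)] r x z by (simp add: B_simps)
  then have "r * B ?a ?a = - 2 * B x ?a" by simp
  moreover have "r = k * k * (r * B ?a ?a)" using k(3) by (simp add: algebra_simps)
  ultimately have "r = - 2 * B x ?a * (k * k)" by (simp add: algebra_simps)
  then show ?thesis using r k x z by (simp add: reflect_def B_simps algebra_simps)
qed

abbreviation lword where "lword us \<equiv> concat (map longest_word us)"

lemma lword_equivariant: "us \<in> lists spherical \<Longrightarrow> equivariant (lword us)"
  by (induction us) (auto simp: equivariant_Nil equivariant_append longest_word_equivariant)

lemma lword_act:
  assumes "us \<in> lists spherical" "x \<in> VG"
  shows "ac (lword us) x = act B orbit_root us x"
  using assms(1)
proof (induction us)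
  case (Cons s us)
  then have "us \<in> lists spherical" by simp
  from equivariant_VG[OF lword_equivariant[OF this] assms(2)] have "ac (lword us) x \<in> VG" .
  then show ?case using longest_word_act[of s "ac (lword us) x"] Cons by simp
qed simp

text \<open>The images of the orbit of \<open>\<epsilon> s\<close> arise from one image by applying
  \<open>G\<close>, which preserves the cone of a stable \<open>X\<close>. This is used for
  \<open>S\<close> and for a union of two orbits.\<close>

lemma equivariant_root_sign:
  assumes u: "equivariant u" and s: "s \<in> S" and X: "X \<subseteq> S" "\<And>g t. g \<in> G \<Longrightarrow> t \<in> X \<Longrightarrow> g t \<in> X"
  shows "ac u (\<epsilon> s) \<in> pos_cone \<epsilon> X \<Longrightarrow> ac u (orbit_sum s) \<in> pos_cone \<epsilon> X"
    and "- ac u (\<epsilon> s) \<in> pos_cone \<epsilon> X \<Longrightarrow> - ac u (orbit_sum s) \<in> pos_cone \<epsilon> X"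
proof -
  have gs: "ac u (\<epsilon> (g s)) = \<rho> g (ac u (\<epsilon> s))" if "g \<in> G" for g
    using u that s by (rule equivariant_root)
  have sum: "ac u (orbit_sum s) = (\<Sum>g\<in>G. \<rho> g (ac u (\<epsilon> s)))"
    using u s by (simp add: orbit_sum_def ac_sum gs)
  show "ac u (orbit_sum s) \<in> pos_cone \<epsilon> X" if "ac u (\<epsilon> s) \<in> pos_cone \<epsilon> X"
    unfolding sum using that X by (intro pos_cone_sum rho_cone) auto
  have "- ac u (orbit_sum s) = (\<Sum>g\<in>G. \<rho> g (- ac u (\<epsilon> s)))"
    using u s by (simp add: sum rho_minus sum_negf)
  then show "- ac u (orbit_sum s) \<in> pos_cone \<epsilon> X" if "- ac u (\<epsilon> s) \<in> pos_cone \<epsilon> X"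
    using that X by (simp only:) (intro pos_cone_sum rho_cone, auto)
qed

text \<open>A root sent to a negative one would take its orbit sum along, but orbit sums lie in
  \<open>V\<^sup>G\<close> and stay fixed. So all signs are positive.\<close>

lemma equivariant_faithful:
  assumes u: "equivariant u" and triv: "\<And>x. x \<in> VG \<Longrightarrow> ac u x = x" and x: "x \<in> V"
  shows "ac u x = x"
proof -
  have "ac u (\<epsilon> s) \<in> pos_cone \<epsilon> S" if s: "s \<in> S" for s
  proof (rule ccontr)
    assume "ac u (\<epsilon> s) \<notin> pos_cone \<epsilon> S"
    then have "- ac u (\<epsilon> s) \<in> pos_cone \<epsilon> S" using ac_root_sign[OF equivariant_lists[OF u] s] by blast
    then have "- ac u (orbit_sum s) \<in> pos_cone \<epsilon> S"
      using equivariant_root_sign(2)[OF u s, of S] by simp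
    moreover have "orbit_sum s \<in> pos_cone \<epsilon> S" using pos_cone_mono orb_S orbit_sum_cone s by blast
    ultimately show False
      using triv[of "orbit_sum s"] s pos_cone_pointed[of "orbit_sum s"] orbit_sum_nonzero[OF s] by simp
  qed
  then have "u \<approx> []" using u by (intro ceq_Nil_if_pos) auto
  then show ?thesis using ceq_act u x by fastforce
qed

text \<open>If an equivariant \<open>w\<close> sends \<open>\<epsilon> s\<close> to a negative root, then it does so on the whole orbit
  of \<open>s\<close>; hence the parabolic part of \<open>w\<close> with respect to that orbit is its longest element,
  which can be split off.\<close>

theorem equivariant_generated:
  "equivariant w \<Longrightarrow> reduced w \<Longrightarrow> \<exists>us\<in>lists spherical. \<forall>x\<in>V. ac w x = ac (lword us) x"
proof (induction "length w" arbitrary: w rule: less_induct)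
  case less
  show ?case
  proof (cases w rule: rev_cases)
    case Nil
    then show ?thesis by (intro bexI[of _ "[]"]) auto
  next
    case (snoc w' s)
    have w: "equivariant w" "w \<in> lists S" and s: "s \<in> S" "w' \<in> lists S"
      using less.prems snoc by (auto simp: equivariant_def)
    let ?X = "orb s"
    interpret X: root_system ?X m V B \<epsilon> using root_system_subset orb_S s by blast
    have "ac w (\<epsilon> s) = ac w' (reflect B (\<epsilon> s) (\<epsilon> s))" using snoc by simp
    also have "reflect B (\<epsilon> s) (\<epsilon> s) = - \<epsilon> s" using s by (simp add: reflect_def scaleR_2)
    also have "ac w' (- \<epsilon> s) = - ac w' (\<epsilon> s)" using s by (simp add: ac_minus)
    finally have neg: "- ac w (\<epsilon> s) \<in> pos_cone \<epsilon> S"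
      using reduced_snoc_pos[of w' s] less.prems snoc by simp
    have negX: "- ac w (\<epsilon> t) \<in> pos_cone \<epsilon> S" if t: "t \<in> ?X" for t
    proof -
      obtain g where g: "g \<in> G" "t = g s" using t by (auto simp: orb_def)
      have "ac w (\<epsilon> t) = \<rho> g (ac w (\<epsilon> s))"
        using equivariant_root[OF w(1) g(1) s(1)] g by simp
      then have "- ac w (\<epsilon> t) = \<rho> g (- ac w (\<epsilon> s))" using g w s by (simp add: rho_minus)
      also have "\<dots> \<in> pos_cone \<epsilon> S" using neg g by (intro rho_cone) auto
      finally show ?thesis .
    qed
    have "reduced (w' @ [s])" "[s] \<in> lists ?X" using less.prems snoc orb_self s by auto
    then obtain v z where vz: "w \<approx> v @ z" "z \<in> lists ?X" "length v \<le> length w'" "reduced (v @ z)"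
      and v: "\<And>t. t \<in> ?X \<Longrightarrow> reduced (v @ [t])"
      using min_coset_decomposition[of w' "[s]" ?X] orb_S[OF s(1)] snoc by metis
    have l: "v \<in> lists S" "z \<in> lists S" using vz(4) by (auto simp: reduced_def)
    have wvz: "ac w x = ac v (ac z x)" if "x \<in> V" for x using ceq_act[OF vz(1) w(2) that] by simp
    have long: "longest ?X z"
      unfolding longest_def
    proof (intro conjI ballI)
      fix t assume t: "t \<in> ?X"
      then have tS: "t \<in> S" using orb_S s by blast
      \<comment> \<open>Each \<open>v t\<close> with \<open>t\<close> in the orbit is reduced, so
        \<open>v\<close> preserves positivity there and a positive \<open>z (\<epsilon> t)\<close>
        would make \<open>w (\<epsilon> t)\<close> positive.\<close>
      have "ac z (\<epsilon> t) \<notin> pos_cone \<epsilon> ?X"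
      proof
        assume "ac z (\<epsilon> t) \<in> pos_cone \<epsilon> ?X"
        then have "ac w (\<epsilon> t) \<in> pos_cone \<epsilon> S"
          using cone_act[OF orb_S[OF s(1)] l(1), of S] reduced_snoc_pos v wvz tS by auto
        then show False using ac_root_not_pos_neg[OF w(2) tS] negX t by blast
      qed
      then show "- ac z (\<epsilon> t) \<in> pos_cone \<epsilon> ?X" using X.ac_root_sign[OF vz(2) t] by blast
    qed (rule vz(2))
    have sph: "s \<in> spherical" unfolding spherical_def using long s(1) by blast
    have ez: "equivariant z" using longest_equivariant s long by blast
    have vw: "ac v x = ac w (ac z x)" if "x \<in> V" for x
      using longest_involution[OF orb_S[OF s(1)] long that] wvz[of "ac z x"] l that by simp
    \<comment> \<open>As \<open>z\<close> is an involution, \<open>v\<close> acts as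
      \<open>w z\<close>, and both factors commute with \<open>G\<close>.\<close>
    have "equivariant v"
      unfolding equivariant_def
      using l vw equivariant_act[OF ez] equivariant_act[OF w(1)] by simp
    moreover have "length v < length w" "reduced v" using vz snoc reduced_prefix by auto
    ultimately obtain us where us: "us \<in> lists spherical" "\<forall>x\<in>V. ac v x = ac (lword us) x"
      using less.hyps by blast
    have "ac w x = ac (lword (us @ [s])) x" if x: "x \<in> V" for x
    proof -
      have "ac w x = ac (lword us) (ac z x)" using wvz[OF x] us(2) l x by simp
      then show ?thesis using longest_unique[OF orb_S[OF s(1)] longest_word[OF sph] long x] by simp
    qed
    then show ?thesis using us(1) sph by (intro bexI[of _ "us @ [s]"]) auto
  qed
qed

subsection \<open>The root basis of orbit sums\<close>

lemma orbit_root_form_nonpos: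
  assumes s: "s \<in> spherical" "t \<in> spherical" and ne: "orb s \<noteq> orb t"
  shows "B (orbit_root s) (orbit_root t) \<le> 0"
proof -
  have st: "s \<in> S" "t \<in> S" using s by simp_all
  have "B (orbit_sum s) (orbit_sum t) = (\<Sum>g\<in>G. \<Sum>h\<in>G. B (\<epsilon> (g s)) (\<epsilon> (h t)))"
    unfolding orbit_sum_def using st by (simp add: B_sum_left B_sum_right) (rule sum.swap)
  also have "\<dots> \<le> 0"
  proof (intro sum_nonpos)
    fix g h assume gh: "g \<in> G" "h \<in> G"
    then have "g s \<in> orb s" "h t \<in> orb t" by (auto simp: orb_def)
    then have "g s \<noteq> h t" using orb_disjoint[OF st ne] by auto
    then show "B (\<epsilon> (g s)) (\<epsilon> (h t)) \<le> 0" using gh st by (intro root_form_nonpos) auto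
  qed
  finally have le: "B (orbit_sum s) (orbit_sum t) \<le> 0" .
  obtain k where k: "0 < k" "orbit_root s = k *\<^sub>R orbit_sum s" using orbit_root_scale[OF s(1)] by metis
  obtain l where l: "0 < l" "orbit_root t = l *\<^sub>R orbit_sum t" using orbit_root_scale[OF s(2)] by metis
  have "B (orbit_root s) (orbit_root t) = k * l * B (orbit_sum s) (orbit_sum t)"
    unfolding k l using st by (simp add: B_simps)
  then show ?thesis using k(1) l(1) le by (simp add: mult_le_0_iff)
qed

text \<open>Averaging collects the coefficients orbit by orbit and keeps their signs, which turns
  membership in the cone into nonnegative coordinates in a plane.\<close>

lemma fixed_cone_two_orbits:
  assumes s: "s \<in> spherical" "t \<in> spherical" and ne: "orb s \<noteq> orb t"
    and y: "y \<in> pos_cone \<epsilon> (orb s \<union> orb t)" "y \<in> VG"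
  shows "\<exists>p q. 0 \<le> p \<and> 0 \<le> q \<and> y = p *\<^sub>R orbit_root s + q *\<^sub>R orbit_root t"
proof -
  let ?Y = "orb s \<union> orb t"
  have st: "s \<in> S" "t \<in> S" using s by simp_all
  have Y: "?Y \<subseteq> S" using orb_S st by simp
  obtain c where c: "y = (\<Sum>r\<in>?Y. c r *\<^sub>R \<epsilon> r)" "\<forall>r\<in>?Y. 0 \<le> c r"
    using y by (auto simp: pos_cone_def)
  have "real (card G) *\<^sub>R y = (\<Sum>r\<in>?Y. c r *\<^sub>R orbit_sum r)"
    using average[OF Y, of c] y c by simp
  also have "\<dots> = (\<Sum>r\<in>orb s. c r *\<^sub>R orbit_sum r) + (\<Sum>r\<in>orb t. c r *\<^sub>R orbit_sum r)"
    using Y finite_S by (intro sum.union_disjoint orb_disjoint st ne) (auto intro: finite_subset)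
  also have "(\<Sum>r\<in>orb s. c r *\<^sub>R orbit_sum r) = sum c (orb s) *\<^sub>R orbit_sum s"
    unfolding scaleR_left.sum by (intro sum.cong) (simp_all add: orbit_sum_orb st)
  also have "(\<Sum>r\<in>orb t. c r *\<^sub>R orbit_sum r) = sum c (orb t) *\<^sub>R orbit_sum t"
    unfolding scaleR_left.sum by (intro sum.cong) (simp_all add: orbit_sum_orb st)
  finally have "(1 / real (card G)) *\<^sub>R (real (card G) *\<^sub>R y)
      = (1 / real (card G)) *\<^sub>R (sum c (orb s) *\<^sub>R orbit_sum s + sum c (orb t) *\<^sub>R orbit_sum t)" by simp
  then have y_eq: "y = (sum c (orb s) / real (card G)) *\<^sub>R orbit_sum s
      + (sum c (orb t) / real (card G)) *\<^sub>R orbit_sum t"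
    using card_G by (simp add: scaleR_add_right)
  obtain k where k: "0 < k" "orbit_sum s = (1 / k) *\<^sub>R orbit_root s" using orbit_root_scale[OF s(1)] by metis
  obtain l where l: "0 < l" "orbit_sum t = (1 / l) *\<^sub>R orbit_root t" using orbit_root_scale[OF s(2)] by metis
  have "y = (sum c (orb s) / real (card G) * (1 / k)) *\<^sub>R orbit_root s
      + (sum c (orb t) / real (card G) * (1 / l)) *\<^sub>R orbit_root t"
    unfolding scaleR_scaleR[symmetric] k(2)[symmetric] l(2)[symmetric] by (rule y_eq)
  moreover have "0 \<le> sum c (orb s)" "0 \<le> sum c (orb t)" using c by (auto intro: sum_nonneg)
  ultimately show ?thesis using k(1) l(1)
    by (intro exI[of _ "sum c (orb s) / real (card G) * (1 / k)"]
        exI[of _ "sum c (orb t) / real (card G) * (1 / l)"]) simp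
qed

text \<open>The Gram determinant \<open>1 - B a b * B a b\<close> is nonzero. In this plane
  coordinates, and hence their signs, are well defined.\<close>

lemma plane_coefficients:
  assumes a: "a \<in> V" "b \<in> V" "B a a = 1" "B b b = 1" "\<bar>B a b\<bar> < 1"
    and eq: "p *\<^sub>R a + q *\<^sub>R b = p' *\<^sub>R a + q' *\<^sub>R b"
  shows "p = p'" "q = q'"
proof -
  let ?d = "B a b"
  have "B a (p *\<^sub>R a + q *\<^sub>R b) = p + q * ?d" "B b (p *\<^sub>R a + q *\<^sub>R b) = p * ?d + q"
    "B a (p' *\<^sub>R a + q' *\<^sub>R b) = p' + q' * ?d" "B b (p' *\<^sub>R a + q' *\<^sub>R b) = p' * ?d + q'"
    using a B_sym[of b a] by (simp_all add: B_simps)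
  then have e: "p + q * ?d = p' + q' * ?d" "p * ?d + q = p' * ?d + q'" unfolding eq by simp_all
  have "(p - p') * (1 - ?d * ?d) = (p + q * ?d - (p' + q' * ?d)) - ?d * (p * ?d + q - (p' * ?d + q'))"
    by (simp add: algebra_simps)
  then have "(p - p') * (1 - ?d * ?d) = 0" using e by simp
  moreover have "?d * ?d < 1" using a(5) by (simp add: abs_square_less_1 flip: power2_eq_square)
  ultimately show "p = p'" by simp
  then show "q = q'" using e by simp
qed

text \<open>If the angle between two orbit roots were not of the form \<open>\<pi> / n\<close>, the alternating product
  with \<open>n = \<lfloor>\<pi> / \<theta>\<rfloor>\<close> factors would send a root to a vector with coefficients of
  opposite signs.\<close>

lemma orbit_root_angle:
  assumes s: "s \<in> spherical" "t \<in> spherical" and ne: "orb s \<noteq> orb t"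
    and gt: "-1 < B (orbit_root s) (orbit_root t)"
  shows "\<exists>n\<ge>2. B (orbit_root s) (orbit_root t) = - cos (pi / real n)"
proof (rule ccontr)
  assume no: "\<not> ?thesis"
  let ?a = "orbit_root s" and ?b = "orbit_root t"
  define c where "c = - B ?a ?b"
  have st: "s \<in> S" "t \<in> S" using s by simp_all
  have c: "0 \<le> c" "c < 1" using orbit_root_form_nonpos[OF s ne] gt by (auto simp: c_def)
  define \<theta> where "\<theta> = arccos c"
  have cos: "cos \<theta> = c" using c by (simp add: \<theta>_def)
  have th: "0 < \<theta>" "\<theta> \<le> pi / 2"
    using c arccos_less_arccos[of c 1] arccos_le_pi2[of c] by (auto simp: \<theta>_def)
  \<comment> \<open>The last multiple of \<open>\<theta>\<close> not beyond \<open>\<pi>\<close>: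
    unless it equals \<open>\<pi>\<close>, the sine is positive there and negative one step later,
    so \<open>U n\<close> and \<open>U (Suc n)\<close> have opposite signs.\<close>
  define n where "n = nat \<lfloor>pi / \<theta>\<rfloor>"
  have "2 \<le> pi / \<theta>" using th by (simp add: field_simps)
  then have fl: "2 \<le> \<lfloor>pi / \<theta>\<rfloor>" by (simp add: le_floor_iff)
  then have n2: "2 \<le> n" by (simp add: n_def nat_le_iff le_nat_iff)
  have rn: "real n = of_int \<lfloor>pi / \<theta>\<rfloor>" using fl by (simp add: n_def)
  then have "real n \<le> pi / \<theta>" "pi / \<theta> < real n + 1" by linarith+
  then have n: "real n * \<theta> \<le> pi" "pi < real n * \<theta> + \<theta>" using th by (auto simp: field_simps)
  have "real n * \<theta> \<noteq> pi"
  proof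
    assume "real n * \<theta> = pi"
    then have "\<theta> = pi / real n" using n2 by (simp add: field_simps)
    then have "B ?a ?b = - cos (pi / real n)" using cos by (simp add: c_def)
    then show False using no n2 by blast
  qed
  then have n': "real n * \<theta> < pi" using n by simp
  define U where "U = cheb c"
  have st0: "0 < sin \<theta>" using th by (intro sin_gt_zero) auto
  have U: "sin \<theta> * U k = sin (real k * \<theta>)" for k using sin_cheb[of \<theta> k] by (simp add: U_def cos)
  have "0 < sin (real n * \<theta>)" using n' n2 th by (intro sin_gt_zero) auto
  then have Un: "0 < U n" using U[of n] st0 by (metis zero_less_mult_pos)
  have "real (Suc n) * \<theta> = real n * \<theta> + \<theta>" by (simp add: algebra_simps)
  then have "sin (real (Suc n) * \<theta>) < 0" using n n' th by (intro sin_lt_zero) auto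
  then have Un1: "U (Suc n) < 0" using U[of "Suc n"] st0 by (metis mult_pos_pos not_less_iff_gr_or_eq mult_zero_right)
  let ?u = "lword (altw s t n)" and ?Y = "orb s \<union> orb t"
  have al: "altw s t n \<in> lists spherical" using set_altw[of s t n] s by (auto simp: in_lists_conv_set)
  have u: "equivariant ?u" using lword_equivariant[OF al] .
  define y where "y = ac ?u ?a"
  have yVG: "y \<in> VG" using u s by (simp add: y_def)
  have "y = act B orbit_root (altw s t n) ?a" using lword_act[OF al] s by (simp add: y_def)
  then have "y = (if even n then U (Suc n) *\<^sub>R ?a + U n *\<^sub>R ?b else U n *\<^sub>R ?a + U (Suc n) *\<^sub>R ?b)"
    using act_altw[of orbit_root s t n] s orbit_root_unit by (simp add: U_def c_def)
  then obtain p q where y: "y = p *\<^sub>R ?a + q *\<^sub>R ?b" and pq: "p * q < 0"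
    using mult_pos_neg[OF Un Un1] mult_neg_pos[OF Un1 Un] by (cases "even n") auto
  have Y: "?Y \<subseteq> S" "\<And>g r. g \<in> G \<Longrightarrow> r \<in> ?Y \<Longrightarrow> g r \<in> ?Y"
    using orb_S orb_closed st by blast+
  interpret Y: root_system ?Y m V B \<epsilon> using root_system_subset Y(1) .
  \<comment> \<open>Only letters from the two orbits occur, so the dichotomy holds in their own
    cone, where it can be compared with \<open>p\<close> and \<open>q\<close>.\<close>
  have "?u \<in> lists ?Y"
    using set_altw[of s t n] longest_word_lists[OF s(1)] longest_word_lists[OF s(2)]
    by (fastforce simp: in_lists_conv_set)
  then have "ac ?u (\<epsilon> s) \<in> pos_cone \<epsilon> ?Y \<or> - ac ?u (\<epsilon> s) \<in> pos_cone \<epsilon> ?Y"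
    using Y.ac_root_sign[of ?u s] orb_self[OF st(1)] by blast
  then have sgn: "ac ?u (orbit_sum s) \<in> pos_cone \<epsilon> ?Y \<or> - ac ?u (orbit_sum s) \<in> pos_cone \<epsilon> ?Y"
    using equivariant_root_sign[OF u st(1) Y(1)] Y(2) by blast
  obtain k where k: "0 < k" "?a = k *\<^sub>R orbit_sum s" using orbit_root_scale[OF s(1)] by metis
  have yk: "y = k *\<^sub>R ac ?u (orbit_sum s)"
    unfolding y_def k(2) using ac_scale[of ?u] equivariant_lists[OF u] st by simp
  have ab: "?a \<in> V" "?b \<in> V" "B ?a ?a = 1" "B ?b ?b = 1" "\<bar>B ?a ?b\<bar> < 1"
    using s orbit_root_unit c by (auto simp: c_def)
  from sgn show False
  proof
    assume "ac ?u (orbit_sum s) \<in> pos_cone \<epsilon> ?Y"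
    then have "y \<in> pos_cone \<epsilon> ?Y" using yk k(1) by (simp add: pos_cone_scale)
    then obtain p' q' where "0 \<le> p'" "0 \<le> q'" "y = p' *\<^sub>R ?a + q' *\<^sub>R ?b"
      using fixed_cone_two_orbits[OF s ne _ yVG] by blast
    then have "0 \<le> p" "0 \<le> q" using plane_coefficients[OF ab, of p q p' q'] y by auto
    then show False using pq by (simp add: mult_less_0_iff)
  next
    assume "- ac ?u (orbit_sum s) \<in> pos_cone \<epsilon> ?Y"
    then have "k *\<^sub>R (- ac ?u (orbit_sum s)) \<in> pos_cone \<epsilon> ?Y" using k(1) by (intro pos_cone_scale) auto
    then have "- y \<in> pos_cone \<epsilon> ?Y" using yk by simp
    moreover have "- y \<in> VG" using yVG subspace_VG by (rule subspace_neg[rotated])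
    ultimately obtain p' q' where "0 \<le> p'" "0 \<le> q'" "- y = p' *\<^sub>R ?a + q' *\<^sub>R ?b"
      using fixed_cone_two_orbits[OF s ne] by blast
    moreover have "- y = (- p) *\<^sub>R ?a + (- q) *\<^sub>R ?b" using y by simp
    ultimately have "0 \<le> - p" "0 \<le> - q" using plane_coefficients[OF ab, of "- p" "- q" p' q'] by auto
    then show False using pq by (simp add: mult_less_0_iff)
  qed
qed

text \<open>Meant for distinct spherical orbits. Within one such orbit the form value is
  \<open>1\<close> and no such \<open>n\<close> exists, hence the diagonal is set separately where a
  Coxeter matrix is formed.\<close>

definition orbit_order :: "'s \<Rightarrow> 's \<Rightarrow> enat" where
  "orbit_order s t = (if -1 < B (orbit_root s) (orbit_root t)
     then enat (SOME n. 2 \<le> n \<and> B (orbit_root s) (orbit_root t) = - cos (pi / real n)) else \<infinity>)"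

lemma orbit_order_cases:
  assumes s: "s \<in> spherical" "t \<in> spherical" and ne: "orb s \<noteq> orb t"
  obtains n where "orbit_order s t = enat n" "2 \<le> n"
      "B (orbit_root s) (orbit_root t) = - cos (pi / real n)"
  | "orbit_order s t = \<infinity>" "B (orbit_root s) (orbit_root t) \<le> -1"
proof (cases "-1 < B (orbit_root s) (orbit_root t)")
  case True
  define n where "n = (SOME n. 2 \<le> n \<and> B (orbit_root s) (orbit_root t) = - cos (pi / real n))"
  have n: "2 \<le> n \<and> B (orbit_root s) (orbit_root t) = - cos (pi / real n)"
    unfolding n_def by (rule someI_ex[OF orbit_root_angle[OF s ne True]])
  have "orbit_order s t = enat n" unfolding orbit_order_def n_def using True by (rule if_P)
  then show ?thesis using that(1) n by blast
qed (use that(2) in \<open>simp add: orbit_order_def\<close>)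

lemma orbit_order_sym:
  assumes "s \<in> spherical" "t \<in> spherical" shows "orbit_order s t = orbit_order t s"
proof -
  have "B (orbit_root s) (orbit_root t) = B (orbit_root t) (orbit_root s)"
    using assms by (intro B_sym) simp_all
  then show ?thesis unfolding orbit_order_def by (rule arg_cong)
qed

lemma longest_word_orb: "orb s = orb t \<Longrightarrow> longest_word s = longest_word t"
  by (simp add: longest_word_def)

lemma fin_dim_VG: "fin_dim_subspace VG"
proof -
  obtain E where E: "finite E" "span E = V"
    using root_basis by (auto simp: root_basis_def fin_dim_subspace_def)
  obtain C where C: "C \<subseteq> VG" "independent C" "VG \<subseteq> span C"
    using maximal_independent_subset[of VG] by blast
  have "C \<subseteq> span E" using C(1) E(2) VG_V by blast
  then have "finite C" using independent_span_bound[OF E(1) C(2)] by blast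
  moreover have "span C = VG" using C subspace_VG by (simp add: span_minimal subset_antisym)
  ultimately show ?thesis unfolding fin_dim_subspace_def by blast
qed

text \<open>The generators of \<open>W\<^sup>G\<close> are indexed here by an arbitrary type, through a map \<open>\<sigma>\<close> choosing
  an element of the corresponding orbit.\<close>

lemma orbit_root_system:
  assumes fin: "finite T" and \<sigma>: "\<sigma> ` T \<subseteq> spherical"
    and inj: "\<And>x y. x \<in> T \<Longrightarrow> y \<in> T \<Longrightarrow> longest_word (\<sigma> x) = longest_word (\<sigma> y) \<Longrightarrow> x = y"
    and inj': "inj_on (\<lambda>x. orbit_root (\<sigma> x)) T"
  defines "m' \<equiv> \<lambda>x y. if x = y then 1 else orbit_order (\<sigma> x) (\<sigma> y)"
  shows "root_system T m' VG B (\<lambda>x. orbit_root (\<sigma> x))"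
proof
  interpret VG: form_space VG B by (rule form_space_VG)
  have sp: "\<sigma> x \<in> spherical" if "x \<in> T" for x using \<sigma> that by auto
  have ne: "orb (\<sigma> x) \<noteq> orb (\<sigma> y)" if "x \<in> T" "y \<in> T" "x \<noteq> y" for x y
    using inj that longest_word_orb by blast
  show "finite T" by (rule fin)
  show "coxeter_matrix T m'"
    unfolding coxeter_matrix_def
  proof (intro conjI ballI impI)
    fix x y assume xy: "x \<in> T" "y \<in> T" "x \<noteq> y"
    show "m' x y = m' y x"
      using orbit_order_sym[OF sp[OF xy(1)] sp[OF xy(2)]] xy(3) by (simp add: m'_def)
    show "2 \<le> m' x y"
      by (rule orbit_order_cases[OF sp[OF xy(1)] sp[OF xy(2)] ne[OF xy]])
        (use xy(3) in \<open>simp_all add: m'_def numeral_eq_enat\<close>)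
  qed (simp add: m'_def)
  obtain \<chi> :: "'v \<Rightarrow> real" where lin: "linear_on V \<chi>" and pos: "\<And>s. s \<in> S \<Longrightarrow> 0 < \<chi> (\<epsilon> s)"
    using root_basis unfolding root_basis_def by blast
  have sc: "\<chi> (c *\<^sub>R y) = c * \<chi> y" if "y \<in> V" for c y
    using lin that by (simp add: linear_on_def)
  have ad: "\<chi> (y + z) = \<chi> y + \<chi> z" if "y \<in> V" "z \<in> V" for y z
    using lin that by (simp add: linear_on_def)
  have \<chi>_sum: "\<chi> (sum x I) = (\<Sum>i\<in>I. \<chi> (x i))"
    if "finite I" "\<And>i. i \<in> I \<Longrightarrow> x i \<in> V" for x and I :: "('s \<Rightarrow> 's) set"
    using that sc[of 0 0] by (induction I rule: finite_induct) (auto simp: ad)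
  have \<chi>_root: "0 < \<chi> (orbit_root s)" if s: "s \<in> spherical" for s
  proof -
    \<comment> \<open>\<open>\<chi>\<close> is not assumed invariant under \<open>G\<close>; it is
      positive on every \<open>\<epsilon> (g s)\<close> and therefore on their sum.\<close>
    have "\<chi> (orbit_sum s) = (\<Sum>g\<in>G. \<chi> (\<epsilon> (g s)))"
      unfolding orbit_sum_def using s G_finite by (intro \<chi>_sum) auto
    also have "\<dots> > 0" using s pos G_finite G_nonempty by (intro sum_pos) auto
    finally have "0 < \<chi> (orbit_sum s)" .
    moreover obtain k where k: "0 < k" "orbit_root s = k *\<^sub>R orbit_sum s"
      using orbit_root_scale[OF s] by metis
    ultimately show ?thesis using s by (simp add: sc)
  qed
  show "root_basis T m' VG B (\<lambda>x. orbit_root (\<sigma> x))"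
    unfolding root_basis_def
  proof (intro conjI ballI impI)
    show "fin_dim_subspace VG" by (rule fin_dim_VG)
    show "symmetric_bilinear_on VG B" by (rule VG.bilin)
    show "(\<lambda>x. orbit_root (\<sigma> x)) ` T \<subseteq> VG" using sp by auto
    show "inj_on (\<lambda>x. orbit_root (\<sigma> x)) T" by (rule inj')
    show "B (orbit_root (\<sigma> x)) (orbit_root (\<sigma> x)) = 1" if "x \<in> T" for x
      using orbit_root_unit sp that by blast
    show "case m' x y of enat n \<Rightarrow> B (orbit_root (\<sigma> x)) (orbit_root (\<sigma> y)) = - cos (pi / real n)
        | \<infinity> \<Rightarrow> B (orbit_root (\<sigma> x)) (orbit_root (\<sigma> y)) \<le> - 1"
      if xy: "x \<in> T" "y \<in> T" "x \<noteq> y" for x y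
      by (rule orbit_order_cases[OF sp[OF xy(1)] sp[OF xy(2)] ne[OF xy]])
        (use xy(3) in \<open>simp_all add: m'_def\<close>)
    show "\<exists>\<chi>::'v \<Rightarrow> real. linear_on VG \<chi> \<and> (\<forall>x\<in>T. 0 < \<chi> (orbit_root (\<sigma> x)))"
    proof (intro exI[of _ \<chi>] conjI ballI)
      show "linear_on VG \<chi>" by (simp add: linear_on_def sc ad)
    qed (use \<chi>_root sp in blast)
  qed
qed

end

section \<open>The fixed subgroup\<close>

lemma Bij_if_GL: "f \<in> carrier (GL V) \<Longrightarrow> f \<in> Bij V"
  by (simp add: GL_def)

lemma GL_mult_apply:
  assumes "f \<in> carrier (GL V)" "g \<in> carrier (GL V)" "x \<in> V"
  shows "(f \<otimes>\<^bsub>GL V\<^esub> g) x = f (g x)"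
  using assms by (simp add: GL_def BijGroup_def compose_eq)

lemma word_eval_letters_append:
  assumes "group W" "S \<subseteq> carrier W" "u \<in> lists S" "v \<in> lists S"
  shows "word_eval W (letters (u @ v)) = word_eval W (letters u) \<otimes>\<^bsub>W\<^esub> word_eval W (letters v)"
  using word_eval_append[OF assms(1,2), of "letters u" "letters v"] assms(3,4) by simp

section \<open>Rooted representations and presentations\<close>

context root_system
begin

lemma word_equiv_iff_act:
  assumes u: "u \<in> words S" and v: "v \<in> words S"
  shows "equivclp (word_reduce S (coxeter_relators S m)) u v
    \<longleftrightarrow> (\<forall>x\<in>V. ac (map fst u) x = ac (map fst v) x)"
proof -
  have "equivclp (word_reduce S (coxeter_relators S m)) u v \<longleftrightarrow> map fst u \<approx> map fst v"
    unfolding cox_equiv_def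
    using word_equiv_letters[OF cox_matrix u] word_equiv_letters[OF cox_matrix v]
      equivclp_sym equivclp_trans by metis
  then show ?thesis using ceq_iff_act u v by (simp add: words_iff_map_fst)
qed

lemma rooted_word_eval:
  assumes W: "group W" "S \<subseteq> carrier W" and f: "rooted_representation W S V B \<epsilon> f"
    and u: "u \<in> words S" and x: "x \<in> V"
  shows "f (word_eval W u) x = ac (map fst u) x"
proof -
  interpret group W by fact
  have car: "f w \<in> carrier (GL V)" if "w \<in> carrier W" for w
    using f that by (auto simp: rooted_representation_def hom_def)
  have mult: "f (w \<otimes>\<^bsub>W\<^esub> w') y = f w (f w' y)" if "w \<in> carrier W" "w' \<in> carrier W" "y \<in> V" for w w' y
  proof -
    have "f (w \<otimes>\<^bsub>W\<^esub> w') = f w \<otimes>\<^bsub>GL V\<^esub> f w'"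
      using f that by (simp add: rooted_representation_def hom_def)
    then show ?thesis using car that by (simp add: GL_mult_apply)
  qed
  have fV: "f w y \<in> V" if "w \<in> carrier W" "y \<in> V" for w y
    using Bij_if_GL[OF car[OF that(1)]] that(2) by (auto simp: Bij_def bij_betw_def)
  \<comment> \<open>The map is idempotent and injective on \<open>V\<close>, hence the identity
    there.\<close>
  have one: "f \<one>\<^bsub>W\<^esub> y = y" if y: "y \<in> V" for y
  proof -
    have "f \<one>\<^bsub>W\<^esub> (f \<one>\<^bsub>W\<^esub> y) = f \<one>\<^bsub>W\<^esub> y" using mult[of "\<one>\<^bsub>W\<^esub>" "\<one>\<^bsub>W\<^esub>" y] y by simp
    moreover have "inj_on (f \<one>\<^bsub>W\<^esub>) V"
      using Bij_if_GL[OF car[OF one_closed]] by (simp add: Bij_def bij_betw_def)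
    ultimately show ?thesis using y fV by (meson inj_onD one_closed)
  qed
  have refl: "f s y = reflect B (\<epsilon> s) y" if "s \<in> S" "y \<in> V" for s y
    using f that by (simp add: rooted_representation_def root_reflection_def reflect_def)
  have refl_inv: "f (inv\<^bsub>W\<^esub> s) y = reflect B (\<epsilon> s) y" if s: "s \<in> S" and y: "y \<in> V" for s y
  proof -
    have sW: "s \<in> carrier W" using s W(2) by auto
    have "f (inv\<^bsub>W\<^esub> s) y = f (inv\<^bsub>W\<^esub> s) (f s (reflect B (\<epsilon> s) y))"
      using s y by (simp add: refl reflect_involution)
    also have "\<dots> = reflect B (\<epsilon> s) y"
      using mult[of "inv\<^bsub>W\<^esub> s" s "reflect B (\<epsilon> s) y"] sW s y one by simp
    finally show ?thesis .
  qed
  show ?thesis using u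
  proof (induction u)
    case (Cons a u)
    then have a: "fst a \<in> S" "u \<in> words S" by (auto simp: words_def)
    have "fst a \<in> carrier W" "inv\<^bsub>W\<^esub> (fst a) \<in> carrier W" using a(1) W(2) by auto
    moreover have "map fst u \<in> lists S" using a(2) by (simp add: words_iff_map_fst)
    ultimately show ?case
      using Cons.IH[OF a(2)] word_eval_closed[OF W a(2)] a x mult refl refl_inv fV by simp
  qed (simp add: one x)
qed

lemma rooted_eq_iff_act:
  assumes W: "group W" "S \<subseteq> carrier W" and f: "rooted_representation W S V B \<epsilon> f"
    and u: "u \<in> words S" and v: "v \<in> words S"
  shows "f (word_eval W u) = f (word_eval W v) \<longleftrightarrow> (\<forall>x\<in>V. ac (map fst u) x = ac (map fst v) x)"
proof
  assume "f (word_eval W u) = f (word_eval W v)"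
  then show "\<forall>x\<in>V. ac (map fst u) x = ac (map fst v) x"
    using rooted_word_eval[OF W f u] rooted_word_eval[OF W f v] by metis
next
  assume a: "\<forall>x\<in>V. ac (map fst u) x = ac (map fst v) x"
  have ext: "f (word_eval W w) \<in> extensional V" if "w \<in> words S" for w
    using f word_eval_closed[OF W that]
    by (auto simp: rooted_representation_def hom_def GL_def Bij_def)
  show "f (word_eval W u) = f (word_eval W v)"
    by (rule extensionalityI[OF ext[OF u] ext[OF v]])
      (use a rooted_word_eval[OF W f u] rooted_word_eval[OF W f v] in auto)
qed

text \<open>In a Coxeter system equality of elements is equivalence of words, and this is equality
  of actions.\<close>

lemma faithful_rooted_representation:
  assumes cs: "coxeter_system W S m" and f: "rooted_representation W S V B \<epsilon> f"
  shows "inj_on f (carrier W)"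
proof (rule inj_onI)
  have W: "group W" "S \<subseteq> carrier W" and surj: "word_eval W ` words S = carrier W"
    and ev: "\<And>u v. u \<in> words S \<Longrightarrow> v \<in> words S \<Longrightarrow>
      word_eval W u = word_eval W v \<longleftrightarrow> equivclp (word_reduce S (coxeter_relators S m)) u v"
    using cs by (auto simp: coxeter_system_def presented_by_def)
  fix x y assume xy: "x \<in> carrier W" "y \<in> carrier W" "f x = f y"
  obtain u v where u: "u \<in> words S" "x = word_eval W u" and v: "v \<in> words S" "y = word_eval W v"
    using xy surj by (metis imageE)
  then show "x = y"
    using xy(3) rooted_eq_iff_act[OF W f u(1) v(1)] word_equiv_iff_act[OF u(1) v(1)] ev by metis
qed

text \<open>The same chain read the other way: faithfulness identifies equality in \<open>W\<close>
  with equality of actions, and the presentation follows without checking any relation inside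
  \<open>W\<close>.\<close>

lemma coxeter_system_if_faithful:
  assumes W: "group W" "S \<subseteq> carrier W" and surj: "word_eval W ` words S = carrier W"
    and f: "rooted_representation W S V B \<epsilon> f" and inj: "inj_on f (carrier W)"
  shows "coxeter_system W S m"
  unfolding coxeter_system_def presented_by_def
proof (intro conjI ballI)
  fix u v assume uv: "u \<in> words S" "v \<in> words S"
  have "word_eval W u = word_eval W v \<longleftrightarrow> f (word_eval W u) = f (word_eval W v)"
    using inj_on_eq_iff[OF inj] word_eval_closed[OF W] uv by metis
  then show "word_eval W u = word_eval W v \<longleftrightarrow> equivclp (word_reduce S (coxeter_relators S m)) u v"
    using rooted_eq_iff_act[OF W f uv] word_equiv_iff_act[OF uv] by blast
qed (fact W surj cox_matrix)+

end

section \<open>The fixed subgroup and its Coxeter generators\<close>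

locale sym_coxeter_system = sym_root_system S m V B \<epsilon> G \<rho>
  for S :: "'w set" and m and V :: "'v::real_vector set" and B and \<epsilon> and G and \<rho> +
  fixes W :: "('w, 'b) monoid_scheme" and f :: "'w \<Rightarrow> 'v \<Rightarrow> 'v"
  assumes cox_system: "coxeter_system W S m" and rooted: "rooted_representation W S V B \<epsilon> f"
begin

lemma W_group: "group W" and S_W: "S \<subseteq> carrier W"
  using cox_system by (auto simp: coxeter_system_def presented_by_def)

abbreviation ev where "ev u \<equiv> word_eval W (letters u)"

lemma ev_closed [simp]: "u \<in> lists S \<Longrightarrow> ev u \<in> carrier W"
  using word_eval_closed[OF W_group S_W] by simp

lemma ev_append: "u \<in> lists S \<Longrightarrow> v \<in> lists S \<Longrightarrow> ev (u @ v) = ev u \<otimes>\<^bsub>W\<^esub> ev v"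
  by (rule word_eval_letters_append[OF W_group S_W])

lemma f_ev: "u \<in> lists S \<Longrightarrow> x \<in> V \<Longrightarrow> f (ev u) x = ac u x"
  using rooted_word_eval[OF W_group S_W rooted, of "letters u" x] by simp

lemma ev_eq_iff:
  assumes "u \<in> lists S" "v \<in> lists S"
  shows "ev u = ev v \<longleftrightarrow> (\<forall>x\<in>V. ac u x = ac v x)"
proof -
  have "ev u = ev v \<longleftrightarrow> f (ev u) = f (ev v)"
    using inj_on_eq_iff[OF faithful_rooted_representation[OF cox_system rooted]] assms by simp
  then show ?thesis
    using rooted_eq_iff_act[OF W_group S_W rooted, of "letters u" "letters v"] assms by simp
qed

lemma ev_surj:
  assumes "w \<in> carrier W" obtains u where "u \<in> lists S" "w = ev u"
proof -
  obtain u where u: "u \<in> words S" "w = word_eval W u"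
    using cox_system assms unfolding coxeter_system_def presented_by_def by (metis imageE)
  have "word_eval W u = ev (map fst u)"
    using word_equiv_letters[OF cox_matrix u(1)] cox_system u(1)
    unfolding coxeter_system_def presented_by_def by (simp add: words_iff_map_fst)
  then show ?thesis using that u by (simp add: words_iff_map_fst)
qed

lemma symmetry_extension:
  assumes g: "g \<in> G"
  shows "symmetry_extension W S g \<in> auto W"
    and "u \<in> lists S \<Longrightarrow> symmetry_extension W S g (ev u) = ev (map g u)"
proof -
  have "g \<in> coxeter_symmetries S m" using sym_G g by (auto simp: symmetry_group_def)
  from theI'[OF ex1_symmetry_extension[OF cox_system this]]
  have a: "symmetry_extension W S g \<in> auto W" "\<forall>s\<in>S. symmetry_extension W S g s = g s"
    unfolding symmetry_extension_def by auto
  show "symmetry_extension W S g \<in> auto W" by fact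
  have "map (apfst g) (letters u) = letters (map g u)" by (simp add: letters_def)
  then show "symmetry_extension W S g (ev u) = ev (map g u)" if "u \<in> lists S"
    using word_eval_hom[OF W_group S_W _ a(2), of "letters u"] a(1) that by (simp add: auto_def)
qed

abbreviation WG where "WG \<equiv> fixed_subgroup W S G"

lemma WG_carrier: "carrier WG = {w \<in> carrier W. \<forall>g\<in>G. symmetry_extension W S g w = w}"
  and WG_mult [simp]: "x \<otimes>\<^bsub>WG\<^esub> y = x \<otimes>\<^bsub>W\<^esub> y"
  and WG_one [simp]: "\<one>\<^bsub>WG\<^esub> = \<one>\<^bsub>W\<^esub>"
  by (simp_all add: fixed_subgroup_def)

text \<open>Being fixed by \<open>g\<close> means that \<open>u\<close> and \<open>map g u\<close>
  represent the same element, hence act alike, and \<open>map g u\<close> acts as the conjugate by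
  \<open>g\<close>.\<close>

lemma ev_WG_iff:
  assumes u: "u \<in> lists S" shows "ev u \<in> carrier WG \<longleftrightarrow> equivariant u"
proof -
  have "ev (map g u) = ev u \<longleftrightarrow> (\<forall>x\<in>V. ac (map g u) x = ac u x)" if g: "g \<in> G" for g
  proof (rule ev_eq_iff)
    show "map g u \<in> lists S" using u g by (auto simp: in_lists_conv_set)
  qed (rule u)
  then show ?thesis using u by (simp add: WG_carrier symmetry_extension(2) equivariant_iff)
qed

lemma WG_surj:
  assumes "w \<in> carrier WG" obtains u where "equivariant u" "w = ev u"
proof -
  have "w \<in> carrier W" using assms by (simp add: WG_carrier)
  then obtain u where u: "u \<in> lists S" "w = ev u" by (rule ev_surj)
  then show ?thesis using that assms ev_WG_iff by simp
qed

lemma WG_group: "group WG"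
proof -
  interpret group W by (rule W_group)
  have hom: "group_hom W W (symmetry_extension W S g)" if "g \<in> G" for g
    using symmetry_extension(1)[OF that]
    by (simp add: group_hom_def group_hom_axioms_def auto_def W_group)
  have "subgroup (carrier WG) W"
  proof (rule subgroupI)
    show "carrier WG \<noteq> {}"
      using hom by (auto simp: WG_carrier intro!: exI[of _ "\<one>\<^bsub>W\<^esub>"] dest: group_hom.hom_one)
  qed (use group_hom.hom_inv[OF hom] group_hom.hom_mult[OF hom] in \<open>auto simp: WG_carrier\<close>)
  then have "group (W\<lparr>carrier := carrier WG\<rparr>)" by (rule subgroup_imp_group)
  then show ?thesis by (simp add: fixed_subgroup_def)
qed

abbreviation fG where "fG \<equiv> fixed_representation V G \<rho> f"

lemma fG_ev: "equivariant u \<Longrightarrow> fG (ev u) = restrict (ac u) VG"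
  unfolding fixed_representation_def by (rule restrict_ext) (simp add: f_ev)

lemma fG_inj: "inj_on fG (carrier WG)"
proof (rule inj_onI)
  fix x y assume xy: "x \<in> carrier WG" "y \<in> carrier WG" "fG x = fG y"
  obtain u where u: "equivariant u" "x = ev u" using xy by (elim WG_surj)
  obtain v where v: "equivariant v" "y = ev v" using xy by (elim WG_surj)
  have ul: "u \<in> lists S" and vl: "v \<in> lists S" "rev v \<in> lists S"
    using u(1) v(1) by (simp_all add: equivariant_rev)
  have eq: "ac u z = ac v z" if "z \<in> VG" for z
    using xy(3) u v that by (metis fG_ev restrict_apply')
  \<comment> \<open>Triviality on \<open>V\<^sup>G\<close> extends to \<open>V\<close> for
    equivariant words, so it is applied to the word for the inverse of \<open>y\<close> times
    \<open>x\<close>.\<close>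
  have eu: "equivariant (rev v @ u)" using u v by (simp add: equivariant_append equivariant_rev)
  have "ac (rev v @ u) z = z" if "z \<in> VG" for z using eq[OF that] ac_rev[OF vl(1)] that by simp
  then have "ac (rev v @ u) z = z" if "z \<in> V" for z using equivariant_faithful[OF eu] that by blast
  then have *: "ac (rev v) (ac u z) = z" if "z \<in> V" for z using that by simp
  have "ac u z = ac v z" if "z \<in> V" for z
    using ac_rev[OF vl(2), of "ac u z"] *[OF that] ul that by simp
  then show "x = y" using ev_eq_iff ul vl u v by simp
qed

lemma fG_hom: "fG \<in> hom WG (GL VG)"
proof (rule homI)
  have car: "fG w \<in> carrier (GL VG)" if w: "w \<in> carrier WG" for w
  proof -
    obtain u where u: "equivariant u" "w = ev u" using w by (elim WG_surj)
    have ul: "u \<in> lists S" "rev u \<in> lists S" using u(1) by (simp_all add: equivariant_rev)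
    have "bij_betw (ac u) VG VG"
    proof (rule bij_betw_byWitness[where f' = "ac (rev u)"])
      show "\<forall>x\<in>VG. ac (rev u) (ac u x) = x" using ac_rev[OF ul(1)] by simp
      show "\<forall>x\<in>VG. ac u (ac (rev u) x) = x" using ac_rev[OF ul(2)] by simp
    qed (use u equivariant_rev in auto)
    then have "fG w \<in> Bij VG" using u by (simp add: fG_ev Bij_def cong: bij_betw_cong)
    moreover have "linear_on VG (fG w)"
      unfolding u(2) fG_ev[OF u(1)] linear_on_def
      using ul subspace_add[OF subspace_VG] subspace_scale[OF subspace_VG]
      by (simp add: ac_add ac_scale)
    ultimately show ?thesis by (simp add: GL_def)
  qed
  show "fG w \<in> carrier (GL VG)" if "w \<in> carrier WG" for w using car that .
  fix x y assume xy: "x \<in> carrier WG" "y \<in> carrier WG"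
  obtain u where u: "equivariant u" "x = ev u" using xy by (elim WG_surj)
  obtain v where v: "equivariant v" "y = ev v" using xy by (elim WG_surj)
  have "fG x \<otimes>\<^bsub>GL VG\<^esub> fG y = compose VG (fG x) (fG y)"
    using Bij_if_GL[OF car[OF xy(1)]] Bij_if_GL[OF car[OF xy(2)]]
    by (simp add: GL_def BijGroup_def)
  moreover have "fG (x \<otimes>\<^bsub>W\<^esub> y) = restrict (ac (u @ v)) VG"
    using u v by (simp add: ev_append[symmetric] equivariant_append fG_ev del: letters_simps)
  moreover have "compose VG (fG x) (fG y) = restrict (ac (u @ v)) VG"
    unfolding compose_def u(2) v(2) fG_ev[OF u(1)] fG_ev[OF v(1)]
    by (rule restrict_ext) (use v(1) in simp)
  ultimately show "fG (x \<otimes>\<^bsub>WG\<^esub> y) = fG x \<otimes>\<^bsub>GL VG\<^esub> fG y" by simp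
qed

definition orbit_gens :: "'w set" where
  "orbit_gens = (\<lambda>s. ev (longest_word s)) ` spherical"

text \<open>The new root basis is indexed by group elements, so each generator needs a chosen
  vertex.\<close>

definition orbit_of_gen :: "'w \<Rightarrow> 'w" where
  "orbit_of_gen w = (SOME s. s \<in> spherical \<and> ev (longest_word s) = w)"

lemma orbit_of_gen:
  assumes "w \<in> orbit_gens"
  shows "orbit_of_gen w \<in> spherical" "ev (longest_word (orbit_of_gen w)) = w"
proof -
  have "\<exists>s. s \<in> spherical \<and> ev (longest_word s) = w" using assms by (auto simp: orbit_gens_def)
  from someI_ex[OF this] show "orbit_of_gen w \<in> spherical" "ev (longest_word (orbit_of_gen w)) = w"
    unfolding orbit_of_gen_def by auto
qed

lemma orbit_gens_WG: "orbit_gens \<subseteq> carrier WG"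
  using ev_WG_iff longest_word_equivariant by (auto simp: orbit_gens_def)

lemma fG_orbit_gen:
  assumes "w \<in> orbit_gens"
  shows "fG w = root_reflection VG B (orbit_root (orbit_of_gen w))"
proof -
  have "fG w = restrict (ac (longest_word (orbit_of_gen w))) VG"
    using fG_ev[OF longest_word_equivariant] orbit_of_gen[OF assms] by metis
  also have "\<dots> = root_reflection VG B (orbit_root (orbit_of_gen w))"
    unfolding root_reflection_def
    by (rule restrict_ext) (simp add: longest_word_act orbit_of_gen[OF assms] reflect_def)
  finally show ?thesis .
qed

lemma orbit_gens_generate: "word_eval WG ` words orbit_gens = carrier WG"
proof
  show "word_eval WG ` words orbit_gens \<subseteq> carrier WG"
    using word_eval_closed[OF WG_group orbit_gens_WG] by auto
  show "carrier WG \<subseteq> word_eval WG ` words orbit_gens"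
  proof
    fix w assume w: "w \<in> carrier WG"
    obtain u where u: "equivariant u" "w = ev u" using w by (elim WG_surj)
    \<comment> \<open>The generation theorem asks for a reduced word; passing to one keeps
      equivariance, which depends on the represented element only.\<close>
    obtain u' where u': "u \<approx> u'" "reduced u'" using reduced_exists equivariant_lists[OF u(1)] by blast
    have ul: "u \<in> lists S" "u' \<in> lists S" using u(1) u'(2) reduced_lists by auto
    have w_eq: "w = ev u'" using ev_eq_iff[OF ul] ceq_iff_act[OF ul] u' u by simp
    then have "equivariant u'" using ev_WG_iff[OF ul(2)] w by simp
    then obtain us where us: "us \<in> lists spherical" "\<forall>x\<in>V. ac u' x = ac (lword us) x"
      using equivariant_generated u'(2) by blast
    have "ev u' = ev (lword us)" using ev_eq_iff[OF ul(2)] us lword_equivariant by simp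
    also have "\<dots> = word_eval WG (letters (map (\<lambda>s. ev (longest_word s)) us))"
      using us(1)
    proof (induction us)
      case (Cons s us)
      then have "ev (lword (s # us)) = ev (longest_word s) \<otimes>\<^bsub>W\<^esub> ev (lword us)"
        using ev_append[of "longest_word s" "lword us"] lword_equivariant[of us]
          longest_word_equivariant[of s] by simp
      then show ?case using Cons by simp
    qed simp
    finally have "ev u' = word_eval WG (letters (map (\<lambda>s. ev (longest_word s)) us))" .
    moreover have "letters (map (\<lambda>s. ev (longest_word s)) us) \<in> words orbit_gens"
      using us(1) by (auto simp: orbit_gens_def in_lists_conv_set)
    ultimately show "w \<in> word_eval WG ` words orbit_gens" unfolding w_eq by blast
  qed
qed

lemma coxeter_system_orbit_gens:
  obtains m' where "coxeter_system WG orbit_gens m'"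
    "root_basis orbit_gens m' VG B (\<lambda>w. orbit_root (orbit_of_gen w))"
    "rooted_representation WG orbit_gens VG B (\<lambda>w. orbit_root (orbit_of_gen w)) fG"
proof -
  let ?m = "\<lambda>x y. if x = y then 1 else orbit_order (orbit_of_gen x) (orbit_of_gen y)"
  have rep: "rooted_representation WG orbit_gens VG B (\<lambda>w. orbit_root (orbit_of_gen w)) fG"
    unfolding rooted_representation_def using fG_hom fG_orbit_gen by blast
  interpret R: root_system orbit_gens ?m VG B "\<lambda>w. orbit_root (orbit_of_gen w)"
  proof (rule orbit_root_system)
    have "spherical \<subseteq> S" by auto
    then show "finite orbit_gens"
      unfolding orbit_gens_def by (rule finite_imageI[OF finite_subset[OF _ finite_S]])
    show "orbit_of_gen ` orbit_gens \<subseteq> spherical" using orbit_of_gen(1) by blast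
    show "x = y" if "x \<in> orbit_gens" "y \<in> orbit_gens"
      "longest_word (orbit_of_gen x) = longest_word (orbit_of_gen y)" for x y
      using that orbit_of_gen(2) by metis
    show "inj_on (\<lambda>w. orbit_root (orbit_of_gen w)) orbit_gens"
    proof (rule inj_onI)
      fix x y assume xy: "x \<in> orbit_gens" "y \<in> orbit_gens"
        "orbit_root (orbit_of_gen x) = orbit_root (orbit_of_gen y)"
      \<comment> \<open>Equal roots define the same reflection of \<open>V\<^sup>G\<close>, and
        \<open>f\<^sup>G\<close> is injective.\<close>
      then have "fG x = fG y" by (simp add: fG_orbit_gen)
      then show "x = y" using inj_onD[OF fG_inj] xy orbit_gens_WG by blast
    qed
  qed
  have "coxeter_system WG orbit_gens ?m"
    by (rule R.coxeter_system_if_faithful[OF WG_group orbit_gens_WG orbit_gens_generate rep fG_inj])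
  then show ?thesis using that R.root_basis rep by blast
qed

end

theorem theorem1p2:
  fixes W :: "('w, 'b) monoid_scheme"
    and S :: "'w set"
    and m :: "'w \<Rightarrow> 'w \<Rightarrow> enat"
    and G :: "('w \<Rightarrow> 'w) set"
    and V :: "'v::real_vector set"
    and B :: "'v \<Rightarrow> 'v \<Rightarrow> real"
    and \<epsilon> :: "'w \<Rightarrow> 'v"
    and \<rho> :: "('w \<Rightarrow> 'w) \<Rightarrow> 'v \<Rightarrow> 'v"
    and f :: "'w \<Rightarrow> 'v \<Rightarrow> 'v"
  assumes "finite S"
    and "coxeter_system W S m"
    and "symmetry_group S m G"
    and "root_basis S m V B \<epsilon>"
    and "embeds_compatibly G S V B \<epsilon> \<rho>"
    and "rooted_representation W S V B \<epsilon> f"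
  shows "(\<exists>S' m'. coxeter_system (fixed_subgroup W S G) S' m') \<and>
         (\<exists>S' m' \<epsilon>'.
            coxeter_system (fixed_subgroup W S G) S' m' \<and>
            root_basis S' m' (fixed_vectors V G \<rho>) B \<epsilon>' \<and>
            rooted_representation (fixed_subgroup W S G) S' (fixed_vectors V G \<rho>) B \<epsilon>'
              (fixed_representation V G \<rho> f)) \<and>
         inj_on (fixed_representation V G \<rho> f) (carrier (fixed_subgroup W S G))"
proof -
  have "coxeter_matrix S m" using assms(2) by (simp add: coxeter_system_def)
  then interpret sym_coxeter_system S m V B \<epsilon> G \<rho> W f
    using assms by unfold_locales
  show ?thesis using coxeter_system_orbit_gens fG_inj by metis
qed

end
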